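(* Let $\mathbf{A}$ be an $n\times n\times n$ tensor with independent $\mathcal{N}(0,1)$ entries and let $\mathbf{A}(x)=\sum_{i,j,k}\mathbf{A}_{ijk}x_ix_jx_k$. There is an absolute constant $C$ such that with probability $1-O(n^{-10})$ the polynomial $\mathbf{A}(x)$ is $\lambda$-bounded with $\lambda= C\, n^{3/4}(\log n)^{1/4}$. Consequently, with the same probability, every degree-$4$ pseudo-expectation $\tilde{\mathbb{E}}$ satisfies $\tilde{\mathbb{E}}\,\mathbf{A}(x)\le C n^{3/4}(\log n)^{1/4}(\tilde{\mathbb{E}}\|x\|^4)^{3/4}$.
   Context: A degree-$d$ pseudo-expectation ($d$ even) is a linear functional $\tilde{\mathbb{E}}:\mathbb{R}[x]_{\le d}\to\mathbb{R}$ with $\tilde{\mathbb{E}}\,1=1$ and $\tilde{\mathbb{E}}\,p(x)^2\ge 0$ for every polynomial $p$ of degree at most $d/2$. A matrix $M\in\mathbb{R}^{n^2\times n^2}$ is a matrix representation of $\|x\|^4$ if $\langle x^{\otimes 2}, M x^{\otimes 2}\rangle=\|x\|^4$. A homogeneous cubic $f$ is $\lambda$-bounded if there exist $A_1,\dots,A_n\in\mathbb{R}^{n\times n}$ with $f(x)=\sum_i x_i\langle x,A_ix\rangle$ and a matrix representation $M$ of $\|x\|^4$ with $\langle u,(\lambda^2M-\sum_iA_i\otimes A_i)u\rangle\ge 0$ for all $u\in\mathbb{R}^{n^2}$. *)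

theory Defs
  imports "HOL-Probability.Probability" "HOL-Library.Poly_Mapping"
begin

text \<open>Real polynomials in the variables x_0, x_1, ... : finitely supported maps
  from monomials (exponent vectors, nat =>0 nat) to real coefficients; the ring
  structure of poly_mapping is the usual polynomial ring (convolution product).\<close>
type_synonym mpoly = "(nat \<Rightarrow>\<^sub>0 nat) \<Rightarrow>\<^sub>0 real"

definition Var :: "nat \<Rightarrow> mpoly" where
  "Var i = Poly_Mapping.single (Poly_Mapping.single i 1) 1"

definition Const :: "real \<Rightarrow> mpoly" where
  "Const c = Poly_Mapping.single 0 c"

definition mon_degree :: "(nat \<Rightarrow>\<^sub>0 nat) \<Rightarrow> nat" where
  "mon_degree m = (\<Sum>i\<in>Poly_Mapping.keys m. Poly_Mapping.lookup m i)"

definition polys :: "nat \<Rightarrow> nat \<Rightarrow> mpoly set" where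
  "polys n d = {p. \<forall>m\<in>Poly_Mapping.keys p. Poly_Mapping.keys m \<subseteq> {..<n} \<and> mon_degree m \<le> d}"

definition eval_poly :: "mpoly \<Rightarrow> (nat \<Rightarrow> real) \<Rightarrow> real" where
  "eval_poly p x = (\<Sum>m\<in>Poly_Mapping.keys p. Poly_Mapping.lookup p m * (\<Prod>i\<in>Poly_Mapping.keys m. x i ^ Poly_Mapping.lookup m i))"

text \<open>Degree-d pseudo-expectation in n variables: a linear functional on
  R[x]_{<=d}, normalised, nonnegative on squares of polynomials of degree <= d/2.
  (Only its values on polys n d are relevant.)\<close>
definition pseudo_expectation :: "nat \<Rightarrow> nat \<Rightarrow> (mpoly \<Rightarrow> real) \<Rightarrow> bool" where
  "pseudo_expectation n d E \<longleftrightarrow>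
     (\<forall>p\<in>polys n d. \<forall>q\<in>polys n d. \<forall>a b.
         E (Const a * p + Const b * q) = a * E p + b * E q)
   \<and> E 1 = 1
   \<and> (\<forall>p\<in>polys n (d div 2). E (p * p) \<ge> 0)"

definition norm4_poly :: "nat \<Rightarrow> mpoly" where
  "norm4_poly n = (\<Sum>i<n. Var i * Var i) ^ 2"

definition cubic_poly :: "nat \<Rightarrow> (nat \<Rightarrow> nat \<Rightarrow> nat \<Rightarrow> real) \<Rightarrow> mpoly" where
  "cubic_poly n T = (\<Sum>i<n. \<Sum>j<n. \<Sum>k<n. Const (T i j k) * Var i * Var j * Var k)"

definition matrep_norm4 :: "nat \<Rightarrow> (nat \<times> nat \<Rightarrow> nat \<times> nat \<Rightarrow> real) \<Rightarrow> bool" where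
  "matrep_norm4 n M \<longleftrightarrow>
     (\<forall>x::nat \<Rightarrow> real.
        (\<Sum>a<n. \<Sum>b<n. \<Sum>c<n. \<Sum>d<n. x a * x b * M (a,b) (c,d) * x c * x d)
        = (\<Sum>i<n. x i ^ 2) ^ 2)"

definition kron :: "(nat \<Rightarrow> nat \<Rightarrow> real) \<Rightarrow> (nat \<Rightarrow> nat \<Rightarrow> real)
                    \<Rightarrow> nat \<times> nat \<Rightarrow> nat \<times> nat \<Rightarrow> real" where
  "kron A B = (\<lambda>(a,b) (c,d). A a c * B b d)"

definition lambda_bounded :: "nat \<Rightarrow> mpoly \<Rightarrow> real \<Rightarrow> bool" where
  "lambda_bounded n f lam \<longleftrightarrow>
     (\<exists>(As :: nat \<Rightarrow> nat \<Rightarrow> nat \<Rightarrow> real) M.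
        (\<forall>x::nat \<Rightarrow> real.
            eval_poly f x = (\<Sum>i<n. x i * (\<Sum>j<n. \<Sum>k<n. x j * As i j k * x k)))
      \<and> matrep_norm4 n M
      \<and> (\<forall>u::nat \<times> nat \<Rightarrow> real.
            (\<Sum>p\<in>{..<n}\<times>{..<n}. \<Sum>q\<in>{..<n}\<times>{..<n}.
               u p * (lam ^ 2 * M p q - (\<Sum>i<n. kron (As i) (As i) p q)) * u q) \<ge> 0))"

definition gauss_tensor :: "nat \<Rightarrow> (nat \<times> nat \<times> nat \<Rightarrow> real) measure" where
  "gauss_tensor n = PiM ({..<n} \<times> {..<n} \<times> {..<n}) (\<lambda>_. std_normal_distribution)"

end

theory Submission
  imports Defs
begin

text \<open>
  Take \<open>A\<^sub>i = (T (i, j, k))\<^sub>j\<^sub>k\<close>. The matrix \<open>\<Sum>\<^sub>i A\<^sub>i \<otimes> A\<^sub>i\<close> has mean \<open>n \<cdot> cup_matrix\<close>, a multiple of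
  a representation of \<open>\<parallel>x\<parallel>\<^sup>4\<close>, so it suffices to bound the symmetric part \<open>Z\<close> of the fluctuation by
  \<open>O(n\<^sup>3\<^sup>/\<^sup>2 (log n)\<^sup>1\<^sup>/\<^sup>2)\<close> as a quadratic form; then \<open>M\<close> is a combination of the identity and the
  cup matrix. For this bound \<open>Z = \<Sum>\<^sub>i Z\<^sub>i\<close> and \<open>E tr Z\<^sup>N\<close>, with \<open>N \<approx> log n\<close> a power of 2, is expanded
  into words in the \<open>Z\<^sub>i\<close> (\<open>sym_kron T i\<close>). A word vanishes in expectation if some letter occurs exactly once,
  there are at most \<open>2 (C N n)\<^sup>N\<^sup>/\<^sup>2\<close> other words, and each of these contributes at most
  \<open>n\<^sup>O\<^sup>(\<^sup>1\<^sup>) (C n)\<^sup>N\<close>, because \<open>\<parallel>Z\<^sub>i\<parallel> \<le> \<parallel>A\<^sub>i\<parallel>\<^sup>2 + n\<close> and \<open>\<parallel>A\<^sub>i\<parallel>\<close> is controlled by a net of lattice points.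

  The bound on pseudo-expectations follows from Cauchy-Schwarz applied to
  \<open>\<Sum>\<^sub>i x\<^sub>i \<langle>x, A\<^sub>i x\<rangle>\<close>, since a positive semidefinite matrix has nonnegative trace product with
  the matrix of fourth pseudo-moments.
\<close>

section \<open>Operator bounds and trace powers\<close>

text \<open>The mean is what makes the choice of \<open>M\<close> matter. Its operator norm is n^2,
  so covering it by a multiple of the identity would only give \<lambda> of order n. The cup matrix
  and the identity define the same form on x \<otimes> x, so an \<open>M\<close> containing n /
  \<lambda>^2 times the cup matrix cancels the mean exactly. What is left is a sum of n independent
  centred matrices of norm about n. Square-root cancellation suggests norm n * n^(1/2), that is
  \<lambda> = n^(3/4); the extra (log n)^(1/4) is the factor N^(N/2) in the number of words after
  taking roots. Polynomial losses in the trace become constants under an N-th root because N is of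
  order log n. The operator norms are unbounded random variables, and restricting to an event where
  they are small could destroy the centring on which the vanishing of words rests. Hence their N-th
  moments are bounded instead of a tail.\<close>

lemma L2_set_squared: "(L2_set f A)\<^sup>2 = (\<Sum>i\<in>A. (f i)\<^sup>2)"
  by (simp add: L2_set_def sum_nonneg)

lemma abs_sum_mult_le_L2_set: "\<bar>\<Sum>i\<in>A. f i * g i\<bar> \<le> L2_set f A * L2_set g A"
proof -
  have "\<bar>\<Sum>i\<in>A. f i * g i\<bar> \<le> (\<Sum>i\<in>A. \<bar>f i\<bar> * \<bar>g i\<bar>)"
    by (rule order_trans[OF sum_abs]) (simp add: abs_mult)
  also have "\<dots> \<le> L2_set f A * L2_set g A" by (rule L2_set_mult_ineq)
  finally show ?thesis .
qed

lemma abs_le_L2_set: "finite A \<Longrightarrow> i \<in> A \<Longrightarrow> \<bar>f i\<bar> \<le> L2_set f A"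
  using member_le_L2_set[of A i "\<lambda>i. \<bar>f i\<bar>"] by (simp add: L2_set_def)

lemma L2_set_product:
  assumes "finite A" "finite B"
  shows "L2_set u (A \<times> B) = L2_set (\<lambda>a. L2_set (\<lambda>b. u (a, b)) B) A"
  unfolding L2_set_def
  by (subst sum.cartesian_product[symmetric, of "\<lambda>a b. (u (a,b))\<^sup>2", simplified])
     (auto intro!: sum.cong simp: sum_nonneg sum.cartesian_product)

text \<open>The bilinear rather than the quadratic form, because the matrices
  \<open>centered_kron T i\<close> need not be symmetric and products of matrices have to be
  estimated.\<close>

definition op_bounded :: "'a set \<Rightarrow> ('a \<Rightarrow> 'a \<Rightarrow> real) \<Rightarrow> real \<Rightarrow> bool" where
  "op_bounded P M s \<longleftrightarrow>
     (\<forall>u v. \<bar>\<Sum>p\<in>P. \<Sum>q\<in>P. u p * M p q * v q\<bar> \<le> s * L2_set u P * L2_set v P)"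

definition matvec :: "'a set \<Rightarrow> ('a \<Rightarrow> 'a \<Rightarrow> real) \<Rightarrow> ('a \<Rightarrow> real) \<Rightarrow> 'a \<Rightarrow> real" where
  "matvec P M v = (\<lambda>p. \<Sum>q\<in>P. M p q * v q)"

definition unitv :: "'a \<Rightarrow> 'a \<Rightarrow> real" where
  "unitv p = (\<lambda>q. if q = p then 1 else 0)"

lemma op_boundedD: "op_bounded P M s \<Longrightarrow> \<bar>\<Sum>p\<in>P. u p * matvec P M v p\<bar> \<le> s * L2_set u P * L2_set v P"
  unfolding op_bounded_def matvec_def by (simp add: sum_distrib_left mult.assoc)

text \<open>Testing the bilinear form against the image vector itself yields the squared length of
  that vector; one factor is then cancelled, which needs the length to be nonzero.\<close>

lemma L2_set_matvec_le:
  assumes "op_bounded P M s" "0 \<le> s"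
  shows "L2_set (matvec P M v) P \<le> s * L2_set v P"
proof (cases "L2_set (matvec P M v) P = 0")
  case False
  then have pos: "L2_set (matvec P M v) P > 0"
    by (simp add: order_less_le)
  have "L2_set (matvec P M v) P * L2_set (matvec P M v) P = (\<Sum>p\<in>P. matvec P M v p * matvec P M v p)"
    using L2_set_squared[of "matvec P M v" P] by (simp add: power2_eq_square)
  also have "\<dots> \<le> (s * L2_set v P) * L2_set (matvec P M v) P"
    using op_boundedD[OF assms(1), of "matvec P M v" v] by (simp add: mult_ac)
  finally show ?thesis using pos by simp
qed (use assms in simp)

lemma L2_set_unitv: "finite P \<Longrightarrow> p \<in> P \<Longrightarrow> L2_set (unitv p) P = 1"
  by (simp add: L2_set_def unitv_def if_distrib[of "\<lambda>x. x^2"] cong: if_cong)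

lemma sum_unitv_mult:
  "finite P \<Longrightarrow> p \<in> P \<Longrightarrow> (\<Sum>q\<in>P. unitv p q * f q) = f p"
  by (simp add: unitv_def if_distrib[of "\<lambda>x. x * _"] cong: if_cong)

lemma sum_mult_unitv:
  "finite P \<Longrightarrow> p \<in> P \<Longrightarrow> (\<Sum>q\<in>P. f q * unitv q p) = f p"
  by (simp add: unitv_def if_distrib[of "\<lambda>x. _ * x"] cong: if_cong)

lemma op_bounded_entry:
  assumes "op_bounded P M s" "finite P" "p \<in> P" "q \<in> P"
  shows "\<bar>M p q\<bar> \<le> s"
proof -
  have "matvec P M (unitv q) p = M p q"
    using assms by (simp add: matvec_def unitv_def if_distrib[of "\<lambda>x. _ * x"] cong: if_cong)
  then show ?thesis
    using op_boundedD[OF assms(1), of "unitv p" "unitv q"] assms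
    by (simp add: L2_set_unitv sum_unitv_mult)
qed

lemma op_bounded_transpose: "op_bounded P M s \<Longrightarrow> op_bounded P (\<lambda>p q. M q p) s"
  unfolding op_bounded_def
proof (intro allI)
  fix u v :: "'a \<Rightarrow> real"
  assume *: "\<forall>u v. \<bar>\<Sum>p\<in>P. \<Sum>q\<in>P. u p * M p q * v q\<bar> \<le> s * L2_set u P * L2_set v P"
  have "(\<Sum>p\<in>P. \<Sum>q\<in>P. u p * M q p * v q) = (\<Sum>q\<in>P. \<Sum>p\<in>P. v q * M q p * u p)"
    by (subst sum.swap) (intro sum.cong refl, simp)
  then show "\<bar>\<Sum>p\<in>P. \<Sum>q\<in>P. u p * M q p * v q\<bar> \<le> s * L2_set u P * L2_set v P"
    using *[rule_format, of v u] by (simp add: mult_ac)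
qed

lemma op_bounded_average:
  assumes "op_bounded P M s" "op_bounded P M' s"
  shows "op_bounded P (\<lambda>p q. (M p q + M' p q) / 2) s"
  unfolding op_bounded_def
proof (intro allI)
  fix u v
  let ?F = "\<lambda>M :: 'a \<Rightarrow> 'a \<Rightarrow> real. \<Sum>p\<in>P. \<Sum>q\<in>P. u p * M p q * v q"
  have 0: "?F (\<lambda>p q. (M p q + M' p q) / 2) = (?F M + ?F M') / 2"
    by (simp add: sum.distrib[symmetric] sum_divide_distrib algebra_simps add_divide_distrib)
  have avg: "\<bar>z\<bar> \<le> c" if "z = (x + y) / 2" "\<bar>x\<bar> \<le> c" "\<bar>y\<bar> \<le> c" for x y z c :: real
    using that by (simp add: abs_le_iff)
  have 1: "\<bar>?F M\<bar> \<le> s * L2_set u P * L2_set v P" and 2: "\<bar>?F M'\<bar> \<le> s * L2_set u P * L2_set v P"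
    using assms unfolding op_bounded_def by auto
  show "\<bar>?F (\<lambda>p q. (M p q + M' p q) / 2)\<bar> \<le> s * L2_set u P * L2_set v P"
    by (rule avg[OF 0 1 2])
qed

text \<open>A product of matrices is represented by its action on vectors: column q of the product
  along \<open>w\<close> is \<open>wordact P Z w (unitv q)\<close>.\<close>

abbreviation wordact :: "'a set \<Rightarrow> ('i \<Rightarrow> 'a \<Rightarrow> 'a \<Rightarrow> real) \<Rightarrow> 'i list \<Rightarrow> ('a \<Rightarrow> real) \<Rightarrow> 'a \<Rightarrow> real" where
  "wordact P Z w v \<equiv> foldr (\<lambda>i. matvec P (Z i)) w v"

lemma wordact_Cons: "wordact P Z (i # w) v p = (\<Sum>q\<in>P. Z i p q * wordact P Z w v q)"
  by (simp, subst matvec_def, rule refl)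

lemma L2_set_wordact_le:
  assumes "\<And>i. i \<in> set w \<Longrightarrow> op_bounded P (Z i) (z i)" "\<And>i. i \<in> set w \<Longrightarrow> 0 \<le> z i"
  shows "L2_set (wordact P Z w v) P \<le> prod_list (map z w) * L2_set v P"
  using assms
proof (induction w)
  case (Cons i w)
  have "L2_set (wordact P Z (i # w) v) P \<le> z i * L2_set (wordact P Z w v) P"
    using Cons.prems by (simp add: L2_set_matvec_le)
  also have "\<dots> \<le> z i * (prod_list (map z w) * L2_set v P)"
    using Cons by (intro mult_left_mono) auto
  finally show ?case by (simp add: mult_ac)
qed simp

text \<open>An entry is at most the length of its column, and the column is the image of a unit
  vector.\<close>

lemma wordact_entry_le:
  assumes "finite P" "p \<in> P" "q \<in> P"
    and "\<And>i. i \<in> set w \<Longrightarrow> op_bounded P (Z i) (z i)" "\<And>i. i \<in> set w \<Longrightarrow> 0 \<le> z i"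
  shows "\<bar>wordact P Z w (unitv q) p\<bar> \<le> prod_list (map z w)"
proof -
  have "\<bar>wordact P Z w (unitv q) p\<bar> \<le> L2_set (wordact P Z w (unitv q)) P"
    using assms by (intro abs_le_L2_set) auto
  also have "\<dots> \<le> prod_list (map z w)"
    using L2_set_wordact_le[of w P Z z "unitv q"] assms by (simp add: L2_set_unitv)
  finally show ?thesis .
qed

lemma wordact_expand:
  assumes "finite P" "p \<in> P"
  shows "wordact P Z w v p = (\<Sum>q\<in>P. v q * wordact P Z w (unitv q) p)"
  using assms(2)
proof (induction w arbitrary: p)
  case Nil
  then show ?case using assms by (simp add: sum_mult_unitv)
next
  case (Cons i w)
  have "wordact P Z (i # w) v p = (\<Sum>r\<in>P. Z i p r * (\<Sum>q\<in>P. v q * wordact P Z w (unitv q) r))"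
    unfolding wordact_Cons by (intro sum.cong refl) (simp only: Cons)
  also have "\<dots> = (\<Sum>q\<in>P. v q * (\<Sum>r\<in>P. Z i p r * wordact P Z w (unitv q) r))"
    unfolding sum_distrib_left by (subst sum.swap) (intro sum.cong refl, simp only: mult_ac)
  finally show ?case unfolding wordact_Cons .
qed

text \<open>Exposes one letter. When it occurs nowhere else in the word, the two outer factors do
  not involve its matrix, and the sum can be integrated term by term against single entries of
  \<open>Z i\<close>.\<close>

lemma wordact_split:
  assumes "finite P" "p \<in> P"
  shows "wordact P Z (w1 @ i # w2) v p =
    (\<Sum>q\<in>P. \<Sum>r\<in>P. wordact P Z w1 (unitv q) p * Z i q r * wordact P Z w2 v r)"
proof -
  have "wordact P Z (w1 @ i # w2) v p = wordact P Z w1 (matvec P (Z i) (wordact P Z w2 v)) p"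
    by simp
  also have "\<dots> = (\<Sum>q\<in>P. matvec P (Z i) (wordact P Z w2 v) q * wordact P Z w1 (unitv q) p)"
    by (rule wordact_expand[OF assms])
  finally show ?thesis by (simp add: matvec_def sum_distrib_right sum_distrib_left mult_ac)
qed

section \<open>Words and the expansion of powers of sums\<close>

definition words :: "'i set \<Rightarrow> nat \<Rightarrow> 'i list set" where
  "words I N = {w. set w \<subseteq> I \<and> length w = N}"

lemma finite_words [simp]: "finite I \<Longrightarrow> finite (words I N)"
  unfolding words_def by (rule finite_lists_length_eq)

lemma sum_words_Suc:
  "(\<Sum>w\<in>words I (Suc N). f w) = (\<Sum>i\<in>I. \<Sum>w\<in>words I N. f (i # w))"
proof -
  have "(\<Sum>w\<in>words I (Suc N). f w) = (\<Sum>(i, w)\<in>I \<times> words I N. f (i # w))"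
    by (rule sum.reindex_bij_witness[of _ "\<lambda>(i, w). i # w" "\<lambda>w. (hd w, tl w)"])
       (auto simp: words_def length_Suc_conv)
  then show ?thesis by (simp add: sum.cartesian_product)
qed

lemma matvec_power_sum:
  assumes "finite I" "finite P"
  shows "(matvec P (\<lambda>p q. \<Sum>i\<in>I. Z i p q) ^^ N) v p = (\<Sum>w\<in>words I N. wordact P Z w v p)"
proof (induction N arbitrary: p)
  case 0
  have "words I 0 = {[]}" by (auto simp: words_def)
  then show ?case by simp
next
  case (Suc N)
  have "(matvec P (\<lambda>p q. \<Sum>i\<in>I. Z i p q) ^^ Suc N) v p
      = (\<Sum>q\<in>P. (\<Sum>i\<in>I. Z i p q) * (\<Sum>w\<in>words I N. wordact P Z w v q))"
    by (simp, subst matvec_def) (simp only: Suc)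
  also have "\<dots> = (\<Sum>q\<in>P. \<Sum>i\<in>I. \<Sum>w\<in>words I N. Z i p q * wordact P Z w v q)"
    by (simp add: sum_product)
  also have "\<dots> = (\<Sum>i\<in>I. \<Sum>w\<in>words I N. \<Sum>q\<in>P. Z i p q * wordact P Z w v q)"
    by (subst sum.swap, rule sum.cong[OF refl], rule sum.swap)
  finally show ?case unfolding sum_words_Suc wordact_Cons .
qed

text \<open>The scalar analogue of the matrix expansion; it turns a moment of a sum of numbers into
  a weighted count of words.\<close>

lemma power_sum_words:
  fixes s :: "'i \<Rightarrow> real"
  shows "(\<Sum>i\<in>I. s i) ^ N = (\<Sum>w\<in>words I N. prod_list (map s w))"
proof (induction N)
  case 0
  have "words I 0 = {[]}" by (auto simp: words_def)
  then show ?case by simp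
qed (simp add: sum_words_Suc sum_product)

section \<open>Symmetric matrices: quadratic forms against traces of powers\<close>

context
  fixes P :: "'a set" and M :: "'a \<Rightarrow> 'a \<Rightarrow> real"
  assumes fin: "finite P" and sym: "\<And>p q. M p q = M q p"
begin

lemma matvec_self_adjoint: "(\<Sum>p\<in>P. u p * matvec P M v p) = (\<Sum>p\<in>P. matvec P M u p * v p)"
  unfolding matvec_def sum_distrib_left sum_distrib_right
  by (subst sum.swap) (auto intro!: sum.cong simp: sym mult_ac)

lemma matvec_power_self_adjoint:
  "(\<Sum>p\<in>P. u p * (matvec P M ^^ k) v p) = (\<Sum>p\<in>P. (matvec P M ^^ k) u p * v p)"
proof (induction k arbitrary: v)
  case (Suc k)
  have "(\<Sum>p\<in>P. u p * (matvec P M ^^ Suc k) v p) = (\<Sum>p\<in>P. (matvec P M ^^ k) u p * matvec P M v p)"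
    unfolding funpow_Suc_right o_def by (rule Suc)
  then show ?case by (simp add: matvec_self_adjoint)
qed simp

lemma matvec_power_double:
  "(\<Sum>p\<in>P. u p * (matvec P M ^^ (2 * k)) u p) = (L2_set ((matvec P M ^^ k) u) P)\<^sup>2"
  using matvec_power_self_adjoint[of u k "(matvec P M ^^ k) u"]
  unfolding L2_set_squared by (simp add: power2_eq_square mult_2 funpow_add)

text \<open>Repeated Cauchy-Schwarz in place of a spectral decomposition: (u . M^k u)^2 is at most
  |u|^2 |M^k u|^2 = |u|^2 (u . M^(2k) u), so every application doubles the exponent. This is why
  only powers of two appear.\<close>

lemma quadratic_form_power2_le:
  "\<bar>\<Sum>p\<in>P. u p * matvec P M u p\<bar> ^ (2 ^ j)
     \<le> (L2_set u P)\<^sup>2 ^ (2 ^ j - 1) * \<bar>\<Sum>p\<in>P. u p * (matvec P M ^^ (2 ^ j)) u p\<bar>"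
proof (induction j)
  case (Suc j)
  let ?q = "\<lambda>k. \<Sum>p\<in>P. u p * (matvec P M ^^ k) u p" and ?L = "(L2_set u P)\<^sup>2"
  have "\<bar>?q (2 ^ j)\<bar>\<^sup>2 \<le> (L2_set u P * L2_set ((matvec P M ^^ (2 ^ j)) u) P)\<^sup>2"
    by (intro power_mono abs_sum_mult_le_L2_set) simp
  also have "\<dots> = ?L * \<bar>?q (2 ^ Suc j)\<bar>"
    by (simp add: power_mult_distrib matvec_power_double)
  finally have sq: "\<bar>?q (2 ^ j)\<bar>\<^sup>2 \<le> ?L * \<bar>?q (2 ^ Suc j)\<bar>" .
  have "\<bar>\<Sum>p\<in>P. u p * matvec P M u p\<bar> ^ (2 ^ Suc j) = (\<bar>\<Sum>p\<in>P. u p * matvec P M u p\<bar> ^ (2 ^ j))\<^sup>2"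
    by (simp add: power_mult[symmetric] mult.commute)
  also have "\<dots> \<le> (?L ^ (2 ^ j - 1) * \<bar>?q (2 ^ j)\<bar>)\<^sup>2"
    by (intro power_mono Suc.IH) simp
  also have "\<dots> = ?L ^ (2 * (2 ^ j - 1)) * \<bar>?q (2 ^ j)\<bar>\<^sup>2"
    by (simp add: power_mult_distrib power_mult[symmetric] mult_ac)
  also have "\<dots> \<le> ?L ^ (2 * (2 ^ j - 1)) * (?L * \<bar>?q (2 ^ Suc j)\<bar>)"
    by (intro mult_left_mono sq) simp
  also have "\<dots> = ?L ^ Suc (2 * (2 ^ j - 1)) * \<bar>?q (2 ^ Suc j)\<bar>"
    by simp
  also have "Suc (2 * (2 ^ j - 1)) = 2 ^ Suc j - (1::nat)"
  proof -
    have "(1::nat) \<le> 2 ^ j" by simp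
    then show ?thesis unfolding power_Suc by linarith
  qed
  finally show ?case .
qed simp

lemma matvec_power_expand:
  assumes "r \<in> P"
  shows "(matvec P M ^^ k) u r = (\<Sum>p\<in>P. u p * (matvec P M ^^ k) (unitv p) r)"
proof -
  have *: "(matvec P M ^^ k) v = wordact P (\<lambda>_::unit. M) (replicate k ()) v" for v
    by (induction k) auto
  show ?thesis unfolding * by (rule wordact_expand[OF fin assms])
qed

text \<open>For an even exponent 2k the form is |M^k u|^2, which is at most |u|^2 times the squared
  Hilbert-Schmidt norm of M^k; by symmetry that norm squared is the trace of M^(2k). The assumption
  on \<open>j\<close> provides the evenness.\<close>

lemma quadratic_form_le_trace:
  assumes "j > 0"
  shows "\<bar>\<Sum>p\<in>P. u p * matvec P M u p\<bar> ^ (2 ^ j)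
     \<le> (L2_set u P)\<^sup>2 ^ (2 ^ j) * (\<Sum>p\<in>P. (matvec P M ^^ (2 ^ j)) (unitv p) p)"
proof -
  let ?L = "(L2_set u P)\<^sup>2"
  obtain k :: nat where k: "2 ^ j = 2 * k"
    using assms by (cases j) auto
  have "(\<Sum>p\<in>P. u p * (matvec P M ^^ (2 * k)) u p) = (L2_set ((matvec P M ^^ k) u) P)\<^sup>2"
    by (rule matvec_power_double)
  also have "\<dots> = (\<Sum>r\<in>P. (\<Sum>p\<in>P. u p * (matvec P M ^^ k) (unitv p) r)\<^sup>2)"
    unfolding L2_set_squared using matvec_power_expand by simp
  also have "\<dots> \<le> (\<Sum>r\<in>P. ?L * (\<Sum>p\<in>P. ((matvec P M ^^ k) (unitv p) r)\<^sup>2))"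
  proof (rule sum_mono)
    fix r
    have "\<bar>\<Sum>p\<in>P. u p * (matvec P M ^^ k) (unitv p) r\<bar>\<^sup>2
        \<le> (L2_set u P * L2_set (\<lambda>p. (matvec P M ^^ k) (unitv p) r) P)\<^sup>2"
      by (intro power_mono abs_sum_mult_le_L2_set) simp
    then show "(\<Sum>p\<in>P. u p * (matvec P M ^^ k) (unitv p) r)\<^sup>2
        \<le> ?L * (\<Sum>p\<in>P. ((matvec P M ^^ k) (unitv p) r)\<^sup>2)"
      by (simp add: power_mult_distrib L2_set_squared)
  qed
  also have "\<dots> = ?L * (\<Sum>p\<in>P. (L2_set ((matvec P M ^^ k) (unitv p)) P)\<^sup>2)"
    unfolding L2_set_squared sum_distrib_left[symmetric] by (subst sum.swap) simp
  also have "\<dots> = ?L * (\<Sum>p\<in>P. (matvec P M ^^ (2 * k)) (unitv p) p)"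
    unfolding matvec_power_double[symmetric] using fin by (simp add: sum_unitv_mult)
  finally have *: "\<bar>\<Sum>p\<in>P. u p * (matvec P M ^^ (2 * k)) u p\<bar>
      \<le> ?L * (\<Sum>p\<in>P. (matvec P M ^^ (2 * k)) (unitv p) p)"
    by (simp add: matvec_power_double)
  have "\<bar>\<Sum>p\<in>P. u p * matvec P M u p\<bar> ^ (2 ^ j)
     \<le> ?L ^ (2 ^ j - 1) * \<bar>\<Sum>p\<in>P. u p * (matvec P M ^^ (2 ^ j)) u p\<bar>"
    by (rule quadratic_form_power2_le)
  also have "\<dots> \<le> ?L ^ (2 ^ j - 1) * (?L * (\<Sum>p\<in>P. (matvec P M ^^ (2 ^ j)) (unitv p) p))"
    using * by (intro mult_left_mono) (auto simp: k)
  also have "\<dots> = ?L ^ (2 ^ j) * (\<Sum>p\<in>P. (matvec P M ^^ (2 ^ j)) (unitv p) p)"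
    using power_minus_mult[of "2 ^ j" ?L] by (simp add: mult.assoc[symmetric])
  finally show ?thesis .
qed

lemma trace_power_nonneg: "j > 0 \<Longrightarrow> 0 \<le> (\<Sum>p\<in>P. (matvec P M ^^ (2 ^ j)) (unitv p) p)"
proof -
  assume "j > 0"
  then obtain k :: nat where k: "2 ^ j = 2 * k" by (cases j) auto
  have "(matvec P M ^^ (2 * k)) (unitv p) p = (L2_set ((matvec P M ^^ k) (unitv p)) P)\<^sup>2" if "p \<in> P" for p
    using matvec_power_double[of "unitv p" k] fin that by (simp add: sum_unitv_mult)
  then show ?thesis unfolding k by (intro sum_nonneg) simp
qed

lemma quadratic_form_le:
  assumes "j > 0" "(\<Sum>p\<in>P. (matvec P M ^^ (2 ^ j)) (unitv p) p) \<le> t ^ (2 ^ j)" "0 \<le> t"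
  shows "(\<Sum>p\<in>P. u p * matvec P M u p) \<le> t * (L2_set u P)\<^sup>2"
proof -
  have "\<bar>\<Sum>p\<in>P. u p * matvec P M u p\<bar> ^ (2 ^ j) \<le> (L2_set u P)\<^sup>2 ^ (2 ^ j) * t ^ (2 ^ j)"
    by (rule order_trans[OF quadratic_form_le_trace]) (use assms in \<open>auto intro: mult_left_mono\<close>)
  also have "\<dots> = (t * (L2_set u P)\<^sup>2) ^ (2 ^ j)"
    by (simp add: power_mult_distrib)
  finally have "\<bar>\<Sum>p\<in>P. u p * matvec P M u p\<bar> \<le> t * (L2_set u P)\<^sup>2"
    by (subst (asm) power_mono_iff) (use assms in auto)
  then show ?thesis by linarith
qed

end

section \<open>Kronecker squares and a net for the operator norm\<close>

lemma sum_Times: "(\<Sum>p\<in>A \<times> B. f p) = (\<Sum>a\<in>A. \<Sum>b\<in>B. f (a, b))"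
  by (simp add: sum.cartesian_product)

text \<open>A \<otimes> A is A acting on one tensor leg followed by A acting on the other. Each of
  the two acts separately on the slices of a vector, and squared slice lengths add up to the squared
  length, so each costs one factor s.\<close>

lemma op_bounded_kron:
  assumes I: "finite I" and A: "op_bounded I A s" and s: "0 \<le> s"
  shows "op_bounded (I \<times> I) (\<lambda>p q. A (fst p) (fst q) * A (snd p) (snd q)) (s\<^sup>2)"
  unfolding op_bounded_def
proof (intro allI)
  fix u v :: "'a \<times> 'a \<Rightarrow> real"
  \<comment> \<open>A applied to the first leg of v. The remaining sum over d applies A to the
    second leg, for each fixed a.\<close>
  define y where "y a d = matvec I A (\<lambda>c. v (c, d)) a" for a d
  have "(\<Sum>p\<in>I \<times> I. \<Sum>q\<in>I \<times> I. u p * (A (fst p) (fst q) * A (snd p) (snd q)) * v q)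
      = (\<Sum>a\<in>I. \<Sum>b\<in>I. \<Sum>c\<in>I. \<Sum>d\<in>I. u (a, b) * (A a c * A b d) * v (c, d))"
    by (simp add: sum_Times)
  also have "\<dots> = (\<Sum>a\<in>I. \<Sum>b\<in>I. \<Sum>d\<in>I. \<Sum>c\<in>I. u (a, b) * (A a c * A b d) * v (c, d))"
    by (rule sum.cong[OF refl], rule sum.cong[OF refl], rule sum.swap)
  also have "\<dots> = (\<Sum>a\<in>I. \<Sum>b\<in>I. u (a, b) * matvec I A (y a) b)"
    by (simp add: matvec_def y_def sum_distrib_left mult_ac)
  finally have eq: "(\<Sum>p\<in>I \<times> I. \<Sum>q\<in>I \<times> I. u p * (A (fst p) (fst q) * A (snd p) (snd q)) * v q)
      = (\<Sum>a\<in>I. \<Sum>b\<in>I. u (a, b) * matvec I A (y a) b)" .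
  let ?U = "\<lambda>a. L2_set (\<lambda>b. u (a, b)) I" and ?Y = "\<lambda>a. L2_set (y a) I"
  have "\<bar>\<Sum>a\<in>I. \<Sum>b\<in>I. u (a, b) * matvec I A (y a) b\<bar>
      \<le> (\<Sum>a\<in>I. \<bar>\<Sum>b\<in>I. u (a, b) * matvec I A (y a) b\<bar>)"
    by (rule sum_abs)
  also have "\<dots> \<le> (\<Sum>a\<in>I. s * (?U a * ?Y a))"
  proof (rule sum_mono)
    fix a
    show "\<bar>\<Sum>b\<in>I. u (a, b) * matvec I A (y a) b\<bar> \<le> s * (?U a * ?Y a)"
      using op_boundedD[OF A, of "\<lambda>b. u (a, b)" "y a"] by (simp only: mult.assoc)
  qed
  also have "\<dots> \<le> s * (L2_set ?U I * L2_set ?Y I)"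
    unfolding sum_distrib_left[symmetric]
    using L2_set_mult_ineq[of ?U ?Y I] s by (intro mult_left_mono) auto
  also have "L2_set ?U I = L2_set u (I \<times> I)"
    by (rule L2_set_product[symmetric]) (use I in auto)
  also have "s * (L2_set u (I \<times> I) * L2_set ?Y I) \<le> s * (L2_set u (I \<times> I) * (s * L2_set v (I \<times> I)))"
  proof (intro mult_left_mono)
    show "L2_set ?Y I \<le> s * L2_set v (I \<times> I)"
  proof (rule power2_le_imp_le)
    have "(L2_set ?Y I)\<^sup>2 = (\<Sum>a\<in>I. \<Sum>d\<in>I. (y a d)\<^sup>2)"
      by (simp only: L2_set_squared)
    also have "\<dots> = (\<Sum>d\<in>I. (L2_set (matvec I A (\<lambda>c. v (c, d))) I)\<^sup>2)"
      unfolding L2_set_squared y_def by (rule sum.swap)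
    also have "\<dots> \<le> (\<Sum>d\<in>I. (s * L2_set (\<lambda>c. v (c, d)) I)\<^sup>2)"
      using L2_set_matvec_le[OF A s] by (intro sum_mono power_mono) auto
    also have "\<dots> = s\<^sup>2 * (\<Sum>d\<in>I. \<Sum>c\<in>I. (v (c, d))\<^sup>2)"
      by (simp only: power_mult_distrib L2_set_squared sum_distrib_left)
    also have "\<dots> = (s * L2_set v (I \<times> I))\<^sup>2"
      unfolding power_mult_distrib L2_set_squared
      by (subst sum.swap) (simp add: sum.cartesian_product)
    finally show "(L2_set ?Y I)\<^sup>2 \<le> (s * L2_set v (I \<times> I))\<^sup>2" .
    qed (use s in simp)
  qed (use s in simp_all)
  finally show "\<bar>\<Sum>p\<in>I \<times> I. \<Sum>q\<in>I \<times> I. u p * (A (fst p) (fst q) * A (snd p) (snd q)) * v q\<bar>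
      \<le> s\<^sup>2 * L2_set u (I \<times> I) * L2_set v (I \<times> I)"
    unfolding eq power2_eq_square by (simp only: mult_ac)
qed

lemma abs_sum_diagonal_le:
  assumes "finite I"
  shows "\<bar>\<Sum>a\<in>I. u (a, a)\<bar> \<le> sqrt (card I) * L2_set u (I \<times> I)"
proof -
  have "\<bar>\<Sum>a\<in>I. 1 * u (a, a)\<bar> \<le> L2_set (\<lambda>_. 1) I * L2_set (\<lambda>a. u (a, a)) I"
    by (rule abs_sum_mult_le_L2_set)
  also have "L2_set (\<lambda>a. u (a, a)) I \<le> L2_set u (I \<times> I)"
  proof (rule power2_le_imp_le)
    have "(\<Sum>a\<in>I. (u (a, a))\<^sup>2) \<le> (\<Sum>a\<in>I. \<Sum>b\<in>I. (u (a, b))\<^sup>2)"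
      using assms by (intro sum_mono member_le_sum) simp_all
    then show "(L2_set (\<lambda>a. u (a, a)) I)\<^sup>2 \<le> (L2_set u (I \<times> I))\<^sup>2"
      unfolding L2_set_squared sum_Times .
  qed simp
  finally show ?thesis by (simp add: L2_set_constant mult_left_mono)
qed

text \<open>The rank-one matrix v v^T with v the sum of e_a \<otimes> e_a. It is the mean of A
  \<otimes> A for a Gaussian matrix A, and its quadratic form at x \<otimes> x is the fourth power
  of the norm of x.\<close>

definition cup_matrix :: "'a \<times> 'a \<Rightarrow> 'a \<times> 'a \<Rightarrow> real" where
  "cup_matrix p q = (if fst p = snd p \<and> fst q = snd q then 1 else 0)"

lemma sum_diagonal:
  assumes "finite I"
  shows "(\<Sum>p\<in>I \<times> I. if fst p = snd p then f p else 0) = (\<Sum>a\<in>I. f (a, a) :: real)"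
  unfolding sum_Times using assms by simp

lemma cup_matrix_form:
  assumes "finite I"
  shows "(\<Sum>p\<in>I \<times> I. \<Sum>q\<in>I \<times> I. u p * cup_matrix p q * v q)
    = (\<Sum>a\<in>I. u (a, a)) * (\<Sum>a\<in>I. v (a, a))"
proof -
  have "(\<Sum>p\<in>I \<times> I. \<Sum>q\<in>I \<times> I. u p * cup_matrix p q * v q)
     = (\<Sum>p\<in>I \<times> I. \<Sum>q\<in>I \<times> I. (if fst p = snd p then u p else 0) * (if fst q = snd q then v q else 0))"
    by (intro sum.cong refl) (auto simp: cup_matrix_def)
  then show ?thesis
    by (simp add: sum_product[symmetric] sum_diagonal[OF assms])
qed

lemma op_bounded_centered_kron:
  assumes I: "finite I" and A: "op_bounded I A s" and s: "0 \<le> s"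
  shows "op_bounded (I \<times> I) (\<lambda>p q. A (fst p) (fst q) * A (snd p) (snd q) - cup_matrix p q) (s\<^sup>2 + card I)"
  unfolding op_bounded_def
proof (intro allI)
  fix u v :: "'a \<times> 'a \<Rightarrow> real"
  let ?P = "I \<times> I"
  have "(\<Sum>p\<in>?P. \<Sum>q\<in>?P. u p * (A (fst p) (fst q) * A (snd p) (snd q) - cup_matrix p q) * v q)
     = (\<Sum>p\<in>?P. \<Sum>q\<in>?P. u p * (A (fst p) (fst q) * A (snd p) (snd q)) * v q)
      - (\<Sum>p\<in>?P. \<Sum>q\<in>?P. u p * cup_matrix p q * v q)" (is "?L = ?X - ?Y")
    by (simp only: sum_subtractf[symmetric] right_diff_distrib left_diff_distrib)
  moreover have "\<bar>?X\<bar> \<le> s\<^sup>2 * L2_set u ?P * L2_set v ?P"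
    using op_bounded_kron[OF assms] unfolding op_bounded_def by blast
  moreover have "\<bar>?Y\<bar> \<le> (sqrt (card I) * L2_set u ?P) * (sqrt (card I) * L2_set v ?P)"
    unfolding cup_matrix_form[OF I] abs_mult
    by (intro mult_mono abs_sum_diagonal_le[OF I]) auto
  then have "\<bar>?Y\<bar> \<le> card I * L2_set u ?P * L2_set v ?P"
    by (simp add: mult_ac) (simp add: mult.assoc[symmetric])
  ultimately show "\<bar>?L\<bar> \<le> (s\<^sup>2 + card I) * L2_set u ?P * L2_set v ?P"
    by (simp add: distrib_right)
qed

text \<open>The integer points of the ball of radius 4 sqrt n; divided by 4 sqrt n they form a net
  of the unit ball. The box makes the set finite and is the range over which the counting argument
  factorises into one sum per coordinate.\<close>

definition netpts :: "nat \<Rightarrow> (nat \<Rightarrow> int) set" where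
  "netpts n = {z \<in> {..<n} \<rightarrow>\<^sub>E {- int (4 * n)..int (4 * n)}. (\<Sum>a<n. (z a)\<^sup>2) \<le> 16 * int n}"

lemma finite_netpts [simp]: "finite (netpts n)"
  unfolding netpts_def
  by (rule finite_subset[OF Collect_restrict finite_PiE]) simp_all

lemma sum_half_power_abs: "(\<Sum>k\<in>{- int m..int m}. (1/2) ^ nat \<bar>k\<bar>) = (3 - 2 * (1/2) ^ m :: real)"
proof (induction m)
  case (Suc m)
  have "{- int (Suc m)..int (Suc m)} = insert (- int (Suc m)) (insert (int (Suc m)) {- int m..int m})"
    unfolding set_eq_iff insert_iff atLeastAtMost_iff of_nat_Suc by presburger
  then have "(\<Sum>k\<in>{- int (Suc m)..int (Suc m)}. (1/2) ^ nat \<bar>k\<bar>)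
      = (1/2) ^ Suc m + ((1/2) ^ Suc m + (\<Sum>k\<in>{- int m..int m}. (1/2) ^ nat \<bar>k\<bar>) :: real)"
    by (simp add: nat_add_distrib)
  then show ?case using Suc by simp
qed simp

text \<open>Each net point has weight at least \<open>2 ^ (- 16 * n)\<close> under the product of the
  weights \<open>2 ^ (- \<bar>k\<bar>)\<close>, since its entries satisfy \<open>\<bar>k\<bar> \<le> k\<^sup>2\<close>.\<close>
lemma card_netpts: "real (card (netpts n)) \<le> (3 * 2 ^ 16) ^ n"
proof -
  let ?S = "{- int (4 * n)..int (4 * n)}"
  have "real (card (netpts n)) = (\<Sum>z\<in>netpts n. 1)" by simp
  also have "\<dots> \<le> (\<Sum>z\<in>netpts n. 2 ^ (16 * n) * (\<Prod>a<n. (1/2) ^ nat \<bar>z a\<bar>))"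
  proof (rule sum_mono)
    fix z assume z: "z \<in> netpts n"
    have "int (\<Sum>a<n. nat \<bar>z a\<bar>) = (\<Sum>a<n. \<bar>z a\<bar>)" by simp
    also have "\<dots> \<le> (\<Sum>a<n. (z a)\<^sup>2)"
    proof (rule sum_mono)
      fix a
      show "\<bar>z a\<bar> \<le> (z a)\<^sup>2"
        using mult_left_mono[of 1 "\<bar>z a\<bar>" "\<bar>z a\<bar>"] by (cases "z a = 0") (auto simp: power2_eq_square)
    qed
    also have "\<dots> \<le> 16 * int n" using z by (simp add: netpts_def)
    finally have "(\<Sum>a<n. nat \<bar>z a\<bar>) \<le> 16 * n" by linarith
    then have "(1/2 :: real) ^ (16 * n) \<le> (1/2) ^ (\<Sum>a<n. nat \<bar>z a\<bar>)"
      by (intro power_decreasing) auto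
    then have "2 ^ (16 * n) * (1/2 :: real) ^ (16 * n) \<le> 2 ^ (16 * n) * (\<Prod>a<n. (1/2) ^ nat \<bar>z a\<bar>)"
      by (intro mult_left_mono) (auto simp: power_sum)
    then show "1 \<le> 2 ^ (16 * n) * (\<Prod>a<n. (1/2 :: real) ^ nat \<bar>z a\<bar>)"
      by (simp add: power_mult_distrib[symmetric])
  qed
  also have "\<dots> \<le> (\<Sum>z\<in>{..<n} \<rightarrow>\<^sub>E ?S. 2 ^ (16 * n) * (\<Prod>a<n. (1/2) ^ nat \<bar>z a\<bar>))"
    unfolding netpts_def
    by (intro sum_mono2 finite_PiE Collect_restrict mult_nonneg_nonneg prod_nonneg) simp_all
  also have "\<dots> = 2 ^ (16 * n) * (\<Prod>a<n. \<Sum>k\<in>?S. (1/2) ^ nat \<bar>k\<bar>)"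
    by (subst prod_sum_PiE) (simp_all add: sum_distrib_left)
  also have "\<dots> \<le> 2 ^ (16 * n) * (\<Prod>a<n. 3)"
  proof (intro mult_left_mono prod_mono conjI)
    have "(1/2 :: real) ^ (4 * n) \<le> 1" by (rule power_le_one) auto
    then show "0 \<le> (\<Sum>k\<in>?S. (1/2 :: real) ^ nat \<bar>k\<bar>)" "(\<Sum>k\<in>?S. (1/2 :: real) ^ nat \<bar>k\<bar>) \<le> 3"
      unfolding sum_half_power_abs by simp_all
  qed simp
  also have "\<dots> = (3 * 2 ^ 16) ^ n"
    by (simp add: power_mult power_mult_distrib[symmetric])
  finally show ?thesis .
qed

text \<open>The spacing 1 / (4 sqrt n) is small enough for n coordinate errors to add up to length
  1/4, and large enough for the net to have only exponentially many points.\<close>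

lemma net_approx:
  assumes n: "n \<ge> 1" and x: "L2_set x {..<n} \<le> 1"
  obtains z where "z \<in> netpts n"
    "L2_set (\<lambda>a. z a / (4 * sqrt n)) {..<n} \<le> 1"
    "L2_set (\<lambda>a. x a - z a / (4 * sqrt n)) {..<n} \<le> 1/4"
proof -
  define h where "h = 4 * sqrt n"
  have h: "h > 0" "h\<^sup>2 = 16 * n" using n by (auto simp: h_def power_mult_distrib)
  \<comment> \<open>Rounding towards zero: no coordinate grows in absolute value, so the rounded
    point stays in the unit ball.\<close>
  define z where "z = (\<lambda>a\<in>{..<n}. if x a \<ge> 0 then \<lfloor>h * x a\<rfloor> else - \<lfloor>h * (- x a)\<rfloor>)"
  have za: "\<bar>real_of_int (z a)\<bar> \<le> h * \<bar>x a\<bar> \<and> \<bar>h * x a - z a\<bar> \<le> 1" if "a < n" for a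
  proof (cases "x a \<ge> 0")
    case True
    then have z: "z a = \<lfloor>h * x a\<rfloor>" using that by (simp add: z_def)
    have "h * x a \<ge> 0" using h True by simp
    then have "0 \<le> \<lfloor>h * x a\<rfloor>" by simp
    then have "0 \<le> real_of_int \<lfloor>h * x a\<rfloor>" by (simp only: of_int_0_le_iff)
    then show ?thesis
      using of_int_floor_le[of "h * x a"] real_of_int_floor_gt_diff_one[of "h * x a"] True
      unfolding z abs_le_iff
      by (simp only: abs_of_nonneg) (intro conjI TrueI; linarith)
  next
    case False
    then have z: "z a = - \<lfloor>h * (- x a)\<rfloor>" using that by (simp add: z_def)
    have "h * (- x a) \<ge> 0" using h False by (intro mult_nonneg_nonneg) auto
    then have "0 \<le> \<lfloor>h * (- x a)\<rfloor>" by (simp only: zero_le_floor)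
    then have "0 \<le> real_of_int \<lfloor>h * (- x a)\<rfloor>" by (simp only: of_int_0_le_iff)
    moreover have "\<bar>x a\<bar> = - x a" "h * (- x a) = - (h * x a)" using False by auto
    ultimately show ?thesis
      using of_int_floor_le[of "h * (- x a)"] real_of_int_floor_gt_diff_one[of "h * (- x a)"]
      unfolding z abs_le_iff of_int_minus
      by (simp only:) (intro conjI; linarith)
  qed
  have za1: "\<bar>z a / h\<bar> \<le> \<bar>x a\<bar>" if "a < n" for a
    using za[OF that] h by (simp add: field_simps abs_divide)
  have za2: "\<bar>x a - z a / h\<bar> \<le> 1 / h" if "a < n" for a
  proof -
    have "x a - z a / h = (h * x a - z a) / h" using h by (simp add: field_simps)
    then show ?thesis using za[OF that] h by (simp add: divide_right_mono)
  qed
  have x1: "(\<Sum>a<n. (x a)\<^sup>2) \<le> 1"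
    using x by (simp add: L2_set_def)
  have s1: "(\<Sum>a<n. (z a / h)\<^sup>2) \<le> 1"
    by (rule order_trans[OF sum_mono x1]) (use za1 in \<open>simp only: abs_le_square_iff[symmetric] lessThan_iff\<close>)
  then have "(\<Sum>a<n. (real_of_int (z a))\<^sup>2) \<le> 16 * n"
    unfolding power_divide sum_divide_distrib[symmetric] h(2) using n by (simp add: pos_divide_le_eq)
  then have "real_of_int (\<Sum>a<n. (z a)\<^sup>2) \<le> real_of_int (16 * int n)"
    by (simp only: of_int_sum of_int_power of_int_mult of_int_numeral of_int_of_nat_eq
        of_nat_mult of_nat_numeral)
  then have sz: "(\<Sum>a<n. (z a)\<^sup>2) \<le> 16 * int n" by (simp only: of_int_le_iff)
  have "z a \<in> {- int (4 * n)..int (4 * n)}" if "a < n" for a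
  proof -
    have "(z a)\<^sup>2 \<le> (\<Sum>a<n. (z a)\<^sup>2)"
      using that by (intro member_le_sum) simp_all
    also have "\<dots> \<le> (16 * int n) * 1" using sz by simp
    also have "\<dots> \<le> (16 * int n) * int n" using n by (intro mult_left_mono) simp_all
    finally have "(z a)\<^sup>2 \<le> (int (4 * n))\<^sup>2" by (simp add: power2_eq_square)
    then have "\<bar>z a\<bar> \<le> \<bar>int (4 * n)\<bar>" by (simp only: abs_le_square_iff)
    then have "\<bar>z a\<bar> \<le> int (4 * n)" by (simp only: abs_of_nat)
    then show ?thesis unfolding atLeastAtMost_iff by linarith
  qed
  then have "z \<in> netpts n"
    using sz unfolding netpts_def PiE_def by (simp add: z_def)
  moreover have "L2_set (\<lambda>a. z a / (4 * sqrt n)) {..<n} \<le> 1"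
    using s1 unfolding L2_set_def h_def by (simp only: real_sqrt_le_1_iff)
  moreover have "L2_set (\<lambda>a. x a - z a / (4 * sqrt n)) {..<n} \<le> 1/4"
  proof -
    have "(\<Sum>a<n. (x a - z a / h)\<^sup>2) \<le> (\<Sum>a<n. (1 / h)\<^sup>2)"
    proof (rule sum_mono)
      fix a assume "a \<in> {..<n}"
      then have "\<bar>x a - z a / h\<bar> \<le> \<bar>1 / h\<bar>"
        using za2[of a] h(1) by (simp only: abs_of_pos zero_less_divide_1_iff lessThan_iff)
      then show "(x a - z a / h)\<^sup>2 \<le> (1 / h)\<^sup>2" by (simp only: abs_le_square_iff)
    qed
    also have "\<dots> = (1/4)\<^sup>2" unfolding power_divide h(2) using n by (simp add: power2_eq_square)
    finally show ?thesis unfolding L2_set_def h_def[symmetric]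
      by (intro real_le_lsqrt sum_nonneg zero_le_power2) simp_all
  qed
  ultimately show ?thesis by (rule that)
qed

text \<open>Let s be the supremum of the bilinear form over the unit balls. Replacing the two
  arguments by net points costs at most s/4 each, so s \<le> \<tau> + s/2. Boundedness of the form
  comes first, since s must be finite for this to give anything. The divisor 16 n is the square of
  the scale 4 sqrt n, and the absolute value is recovered from the one-sided bound by negating
  x.\<close>

lemma op_bounded_of_net:
  assumes n: "n \<ge> 1"
    and net: "\<And>z z'. z \<in> netpts n \<Longrightarrow> z' \<in> netpts n \<Longrightarrow>
       (\<Sum>a<n. \<Sum>c<n. z a * A a c * z' c) / (16 * n) \<le> \<tau>"
  shows "op_bounded {..<n} A (2 * \<tau>)"
proof -
  define F where "F x y = (\<Sum>a<n. \<Sum>c<n. x a * A a c * y c)" for x y :: "nat \<Rightarrow> real"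
  let ?L = "\<lambda>x. L2_set x {..<n}"
  define B where "B = {F x y | x y. ?L x \<le> 1 \<and> ?L y \<le> 1}"
  define s where "s = Sup B"
  have bdd: "bdd_above B"
  proof (rule bdd_aboveI)
    fix b assume "b \<in> B"
    then obtain x y where xy: "b = F x y" "?L x \<le> 1" "?L y \<le> 1" by (auto simp: B_def)
    have "b \<le> (\<Sum>a<n. \<Sum>c<n. \<bar>A a c\<bar>)"
      unfolding xy F_def
    proof (intro sum_mono)
      fix a c assume "a \<in> {..<n}" "c \<in> {..<n}"
      then have "\<bar>x a\<bar> \<le> 1" "\<bar>y c\<bar> \<le> 1"
        using abs_le_L2_set[of "{..<n}" a x] abs_le_L2_set[of "{..<n}" c y] xy by auto
      then have "\<bar>x a\<bar> * \<bar>A a c\<bar> * \<bar>y c\<bar> \<le> 1 * \<bar>A a c\<bar> * 1"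
        by (intro mult_mono) auto
      then show "x a * A a c * y c \<le> \<bar>A a c\<bar>"
        using abs_ge_self[of "x a * A a c * y c"] by (simp add: abs_mult)
    qed
    then show "b \<le> (\<Sum>a<n. \<Sum>c<n. \<bar>A a c\<bar>)" .
  qed
  have scale: "F (\<lambda>a. c * x a) (\<lambda>a. d * y a) = c * d * F x y" for c d x y
    by (simp add: F_def sum_distrib_left mult_ac)
  have le: "F x y \<le> s * ?L x * ?L y" for x y
  proof (cases "?L x = 0 \<or> ?L y = 0")
    case True
    then have "F x y = 0" by (auto simp: L2_set_eq_0_iff F_def)
    then show ?thesis using True by auto
  next
    case False
    then have pos: "?L x > 0" "?L y > 0" by (auto simp: order_less_le)
    have unit: "?L (\<lambda>a. (1 / ?L x) * x a) = 1" if "?L x > 0" for x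
      using that by (subst L2_set_right_distrib[symmetric]) auto
    have "F (\<lambda>a. (1 / ?L x) * x a) (\<lambda>a. (1 / ?L y) * y a) \<le> s"
      unfolding s_def by (rule cSup_upper[OF _ bdd]) (use unit pos in \<open>force simp: B_def\<close>)
    then show ?thesis unfolding scale using pos by (simp add: field_simps)
  qed
  have abs_le: "\<bar>F x y\<bar> \<le> s * ?L x * ?L y" for x y
    using le[of x y] le[of "\<lambda>a. (-1) * x a" y] scale[of "-1" x 1 y]
    by (auto simp: abs_le_iff L2_set_def)
  have "F (\<lambda>_. 0) (\<lambda>_. 0) \<in> B" by (auto simp: B_def L2_set_0' intro!: exI[of _ "\<lambda>_. 0"])
  then have ne: "B \<noteq> {}" and s0: "0 \<le> s"
    using cSup_upper[OF _ bdd] by (auto simp: s_def F_def)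
  have "s \<le> \<tau> + s / 2"
    unfolding s_def
  proof (rule cSup_least[OF ne], unfold s_def[symmetric])
    fix b assume "b \<in> B"
    then obtain x y where xy: "b = F x y" "?L x \<le> 1" "?L y \<le> 1" by (auto simp: B_def)
    obtain z where z: "z \<in> netpts n" "?L (\<lambda>a. z a / (4 * sqrt n)) \<le> 1"
      "?L (\<lambda>a. x a - z a / (4 * sqrt n)) \<le> 1/4" by (rule net_approx[OF n xy(2)])
    obtain z' where z': "z' \<in> netpts n" "?L (\<lambda>a. z' a / (4 * sqrt n)) \<le> 1"
      "?L (\<lambda>a. y a - z' a / (4 * sqrt n)) \<le> 1/4" by (rule net_approx[OF n xy(3)])
    let ?x = "\<lambda>a. z a / (4 * sqrt n)" and ?y = "\<lambda>a. z' a / (4 * sqrt n)"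
    have "F x y = F ?x ?y + F (\<lambda>a. x a - ?x a) y + F ?x (\<lambda>a. y a - ?y a)"
    proof -
      have "x * A * y = x' * A * y' + (x - x') * A * y + x' * A * (y - y')" for x x' y y' A :: real
        by algebra
      then show ?thesis unfolding F_def sum.distrib[symmetric] by (intro sum.cong refl)
    qed
    moreover have "F ?x ?y = (\<Sum>a<n. \<Sum>c<n. z a * A a c * z' c) / (16 * n)"
      using n by (simp add: F_def sum_divide_distrib)
    moreover have "\<dots> \<le> \<tau>" using net z z' by blast
    moreover have "F (\<lambda>a. x a - ?x a) y \<le> s * (1/4) * 1"
      by (rule order_trans[OF le]) (intro mult_mono mult_left_mono z z' xy s0, auto simp: s0)
    moreover have "F ?x (\<lambda>a. y a - ?y a) \<le> s * 1 * (1/4)"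
      by (rule order_trans[OF le]) (intro mult_mono mult_left_mono z z' xy s0, auto simp: s0)
    ultimately show "b \<le> \<tau> + s / 2" using xy by simp
  qed
  then have s2: "s \<le> 2 * \<tau>" by simp
  have "\<bar>F x y\<bar> \<le> 2 * \<tau> * ?L x * ?L y" for x y
    by (rule order_trans[OF abs_le]) (intro mult_right_mono s2 L2_set_nonneg)
  then show ?thesis by (simp add: op_bounded_def F_def)
qed

section \<open>Gaussian tensors\<close>

abbreviation pairs :: "nat \<Rightarrow> (nat \<times> nat) set" where
  "pairs n \<equiv> {..<n} \<times> {..<n}"

lemma gauss_exp:
  shows integrable_gauss_exp: "integrable std_normal_distribution (\<lambda>x. exp (t * x))"
    and integral_gauss_exp: "(\<integral>x. exp (t * x) \<partial>std_normal_distribution) = exp (t\<^sup>2 / 2)"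
proof -
  \<comment> \<open>Completing the square leaves a constant times the normal density with mean
    t.\<close>
  have eq: "std_normal_density x *\<^sub>R exp (t * x) = exp (t\<^sup>2 / 2) * normal_density t 1 x" for x
    by (simp add: normal_density_def exp_add[symmetric] power2_eq_square field_simps)
  show "integrable std_normal_distribution (\<lambda>x. exp (t * x))"
    by (subst integrable_density) (simp_all only: eq, auto)
  show "(\<integral>x. exp (t * x) \<partial>std_normal_distribution) = exp (t\<^sup>2 / 2)"
    by (subst integral_density) (simp_all only: eq, auto)
qed

lemma gauss_moments:
  shows "integrable std_normal_distribution (\<lambda>x. x)"
    "(\<integral>x. x \<partial>std_normal_distribution) = 0"
    "integrable std_normal_distribution (\<lambda>x. x\<^sup>2)"
    "(\<integral>x. x\<^sup>2 \<partial>std_normal_distribution) = 1"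
proof -
  have a: "has_bochner_integral lborel (\<lambda>x. std_normal_density x * x) 0"
    using std_normal_moment_odd[of 0] by simp
  have b: "has_bochner_integral lborel (\<lambda>x. std_normal_density x * x\<^sup>2) 1"
    using std_normal_moment_even[of 1] by (simp add: fact_numeral)
  show "integrable std_normal_distribution (\<lambda>x. x)" "integrable std_normal_distribution (\<lambda>x. x\<^sup>2)"
    using a b by (auto simp: integrable_density has_bochner_integral_iff)
  show "(\<integral>x. x \<partial>std_normal_distribution) = 0" "(\<integral>x. x\<^sup>2 \<partial>std_normal_distribution) = 1"
    using a b by (auto simp: integral_density has_bochner_integral_iff)
qed

interpretation G: product_sigma_finite "\<lambda>_::'a. std_normal_distribution"
  by (intro product_sigma_finite.intro prob_space_imp_sigma_finite prob_space_normal_density) simp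

lemma
  fixes J :: "'a set"
  assumes "finite J"
  shows integrable_gauss_exp_linear:
      "integrable (Pi\<^sub>M J (\<lambda>_. std_normal_distribution)) (\<lambda>T. exp (\<Sum>\<alpha>\<in>J. t \<alpha> * T \<alpha>))"
    and integral_gauss_exp_linear:
      "(\<integral>T. exp (\<Sum>\<alpha>\<in>J. t \<alpha> * T \<alpha>) \<partial>Pi\<^sub>M J (\<lambda>_. std_normal_distribution))
        = exp ((\<Sum>\<alpha>\<in>J. (t \<alpha>)\<^sup>2) / 2)"
proof -
  have eq: "exp (\<Sum>\<alpha>\<in>J. t \<alpha> * T \<alpha>) = (\<Prod>\<alpha>\<in>J. exp (t \<alpha> * T \<alpha>))" for T
    using assms by (rule exp_sum)
  show "integrable (Pi\<^sub>M J (\<lambda>_. std_normal_distribution)) (\<lambda>T. exp (\<Sum>\<alpha>\<in>J. t \<alpha> * T \<alpha>))"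
    unfolding eq by (rule G.product_integrable_prod[OF assms integrable_gauss_exp])
  show "(\<integral>T. exp (\<Sum>\<alpha>\<in>J. t \<alpha> * T \<alpha>) \<partial>Pi\<^sub>M J (\<lambda>_. std_normal_distribution))
        = exp ((\<Sum>\<alpha>\<in>J. (t \<alpha>)\<^sup>2) / 2)"
    unfolding eq G.product_integral_prod[OF assms integrable_gauss_exp]
    by (simp add: integral_gauss_exp exp_sum[OF assms, symmetric] sum_divide_distrib)
qed

lemma prob_space_gauss_tensor: "prob_space (gauss_tensor n)"
  unfolding gauss_tensor_def by (intro prob_space_PiM prob_space_normal_density) simp

lemma gauss_tensor_component [measurable]:
  assumes "i < n" "a < n" "c < n"
  shows "(\<lambda>T. T (i, a, c)) \<in> borel_measurable (gauss_tensor n)"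
proof -
  have "(\<lambda>T. T (i, a, c)) \<in> measurable (gauss_tensor n) std_normal_distribution"
    unfolding gauss_tensor_def using assms by (intro measurable_component_singleton) auto
  then show ?thesis by (simp add: measurable_def)
qed

text \<open>Fubini with the coordinate \<alpha> innermost. A word with a single letter is killed
  through this, one entry of that letter at a time.\<close>

lemma integral_zero_coordinate:
  assumes J: "finite J" "\<alpha> \<in> J"
    and f: "integrable (Pi\<^sub>M J (\<lambda>_. std_normal_distribution)) f"
    and zero: "\<And>x. (\<integral>y. f (x(\<alpha> := y)) \<partial>std_normal_distribution) = (0::real)"
  shows "(\<integral>T. f T \<partial>Pi\<^sub>M J (\<lambda>_. std_normal_distribution)) = 0"
proof -
  have "insert \<alpha> (J - {\<alpha>}) = J" using J by auto
  with G.product_integral_insert[of "J - {\<alpha>}" \<alpha> f] f J(1) show ?thesis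
    by (simp add: zero)
qed

definition centered_kron :: "(nat \<times> nat \<times> nat \<Rightarrow> real) \<Rightarrow> nat \<Rightarrow> nat \<times> nat \<Rightarrow> nat \<times> nat \<Rightarrow> real" where
  "centered_kron T i p q = T (i, fst p, fst q) * T (i, snd p, snd q) - cup_matrix p q"

definition sym_kron :: "(nat \<times> nat \<times> nat \<Rightarrow> real) \<Rightarrow> nat \<Rightarrow> nat \<times> nat \<Rightarrow> nat \<times> nat \<Rightarrow> real" where
  "sym_kron T i p q = (centered_kron T i p q + centered_kron T i q p) / 2"

definition netform :: "nat \<Rightarrow> (nat \<times> nat \<times> nat \<Rightarrow> real) \<Rightarrow> nat \<Rightarrow> (nat \<Rightarrow> int) \<Rightarrow> (nat \<Rightarrow> int) \<Rightarrow> real" where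
  "netform n T i z z' = (\<Sum>a<n. \<Sum>c<n. z a * T (i, a, c) * z' c) / (16 * n)"

text \<open>The square counts pairs of net points, per dimension; the factor e dominates the
  Gaussian exponential moment, per dimension.\<close>

definition net_const :: real where "net_const = (3 * 2 ^ 16)\<^sup>2 * exp 1"

text \<open>A smooth substitute for the maximum of \<open>netform\<close> over the net: it dominates
  each single exponential, and its expectation can be computed termwise.\<close>

definition net_exp_sum :: "nat \<Rightarrow> (nat \<times> nat \<times> nat \<Rightarrow> real) \<Rightarrow> nat \<Rightarrow> real" where
  "net_exp_sum n T i = (\<Sum>z\<in>netpts n. \<Sum>z'\<in>netpts n. exp (sqrt n * netform n T i z z')) / net_const ^ n"

lemma net_const_ge_1: "net_const \<ge> 1"
proof -
  have "(1::real) * 1 \<le> (3 * 2 ^ 16)\<^sup>2 * exp 1" by (intro mult_mono) auto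
  then show ?thesis by (simp add: net_const_def)
qed

lemma net_exp_sum_nonneg: "0 \<le> net_exp_sum n T i"
  unfolding net_exp_sum_def using net_const_ge_1 by (intro divide_nonneg_nonneg sum_nonneg) auto

text \<open>For fixed net points \<open>netform\<close> is a linear form in the Gaussian entries
  whose coefficients have square sum at most 1. After multiplication by sqrt n its exponential
  moment is at most exp (n/2), and \<open>net_const ^ n\<close> pays for this and for the number of
  pairs.\<close>

lemma integrable_net_exp_sum:
  assumes "i < n"
  shows "integrable (gauss_tensor n) (\<lambda>T. net_exp_sum n T i)"
    and "(\<integral>T. net_exp_sum n T i \<partial>gauss_tensor n) \<le> 1"
proof -
  have n: "n > 0" using assms by simp
  let ?J = "{..<n} \<times> pairs n"
  define t where "t z z' = (\<lambda>(j, a, c). if j = i then sqrt n * (z a * z' c / (16 * n)) else 0)"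
    for z z' :: "nat \<Rightarrow> int"
  have lin: "sqrt n * netform n T i z z' = (\<Sum>\<alpha>\<in>?J. t z z' \<alpha> * T \<alpha>)" for T z z'
  proof -
    have "(\<Sum>\<alpha>\<in>?J. t z z' \<alpha> * T \<alpha>)
      = (\<Sum>j<n. if j = i then \<Sum>a<n. \<Sum>c<n. sqrt n * (z a * z' c / (16 * n)) * T (i, a, c) else 0)"
      unfolding sum_Times by (intro sum.cong refl) (simp add: t_def)
    also have "\<dots> = (\<Sum>a<n. \<Sum>c<n. sqrt n * (z a * z' c / (16 * n)) * T (i, a, c))"
      using assms by simp
    finally show ?thesis
      by (simp add: netform_def sum_distrib_left sum_divide_distrib mult_ac)
  qed
  have sq: "(\<Sum>\<alpha>\<in>?J. (t z z' \<alpha>)\<^sup>2) \<le> n" if "z \<in> netpts n" "z' \<in> netpts n" for z z'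
  proof -
    have b: "(\<Sum>a<n. (real_of_int (z a))\<^sup>2) \<le> 16 * real n" if "z \<in> netpts n" for z
    proof -
      have "real_of_int (\<Sum>a<n. (z a)\<^sup>2) \<le> real_of_int (16 * int n)"
        using that unfolding netpts_def by (simp only: of_int_le_iff) simp
      then show ?thesis by simp
    qed
    have "(\<Sum>\<alpha>\<in>?J. (t z z' \<alpha>)\<^sup>2)
      = (\<Sum>j<n. if j = i then \<Sum>a<n. \<Sum>c<n. (sqrt n * (z a * z' c / (16 * n)))\<^sup>2 else 0)"
      unfolding sum_Times by (intro sum.cong refl) (simp add: t_def)
    also have "\<dots> = (\<Sum>a<n. \<Sum>c<n. (sqrt n * (z a * z' c / (16 * n)))\<^sup>2)"
      using assms by simp
    also have "\<dots> = (\<Sum>a<n. \<Sum>c<n. (real_of_int (z a))\<^sup>2 * (real_of_int (z' c))\<^sup>2 / (256 * n))"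
      using n by (intro sum.cong refl)
        (simp add: power_mult_distrib power_divide, simp add: power2_eq_square)
    also have "\<dots> = (\<Sum>a<n. (real_of_int (z a))\<^sup>2) * (\<Sum>a<n. (real_of_int (z' a))\<^sup>2) / (256 * n)"
      by (simp add: sum_product sum_divide_distrib)
    also have "\<dots> \<le> (16 * real n) * (16 * real n) / (256 * n)"
      by (rule divide_right_mono[OF mult_mono[OF b[OF that(1)] b[OF that(2)]]]) (simp_all add: sum_nonneg)
    also have "\<dots> = n" using n by simp
    finally show ?thesis .
  qed
  have J: "finite ?J" by simp
  show int: "integrable (gauss_tensor n) (\<lambda>T. net_exp_sum n T i)"
    unfolding net_exp_sum_def lin gauss_tensor_def
    by (intro Bochner_Integration.integrable_sum integrable_divide integrable_gauss_exp_linear[OF J])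
  have "(\<integral>T. net_exp_sum n T i \<partial>gauss_tensor n)
     = (\<Sum>z\<in>netpts n. \<Sum>z'\<in>netpts n. exp ((\<Sum>\<alpha>\<in>?J. (t z z' \<alpha>)\<^sup>2) / 2)) / net_const ^ n"
    unfolding net_exp_sum_def lin gauss_tensor_def
    by (simp add: Bochner_Integration.integral_sum integrable_gauss_exp_linear[OF J]
        integral_gauss_exp_linear[OF J] Bochner_Integration.integrable_sum)
  also have "\<dots> \<le> (\<Sum>z\<in>netpts n. \<Sum>z'\<in>netpts n. exp (real n)) / net_const ^ n"
  proof (intro divide_right_mono sum_mono)
    fix z z' assume "z \<in> netpts n" "z' \<in> netpts n"
    from sq[OF this] show "exp ((\<Sum>\<alpha>\<in>?J. (t z z' \<alpha>)\<^sup>2) / 2) \<le> exp (real n)"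
      using n by (subst exp_le_cancel_iff) linarith
  qed (use net_const_ge_1 in simp)
  also have "\<dots> = real (card (netpts n)) * real (card (netpts n)) * exp (real n) / net_const ^ n"
    by simp
  also have "\<dots> \<le> (3 * 2 ^ 16) ^ n * (3 * 2 ^ 16) ^ n * exp (real n) / net_const ^ n"
    using net_const_ge_1 by (intro divide_right_mono mult_mono card_netpts) auto
  also have "\<dots> = 1"
  proof -
    have "exp (real n) = exp 1 ^ n" by (simp add: exp_of_nat_mult[symmetric])
    then have "(3 * 2 ^ 16) ^ n * (3 * 2 ^ 16) ^ n * exp (real n) = net_const ^ n"
      unfolding net_const_def power2_eq_square by (simp only: power_mult_distrib)
    moreover have "net_const ^ n \<noteq> 0" using net_const_ge_1 by auto
    ultimately show ?thesis by simp
  qed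
  finally show "(\<integral>T. net_exp_sum n T i \<partial>gauss_tensor n) \<le> 1" .
qed

text \<open>With \<open>u = max netform / \<surd>n\<close> the operator bound is \<open>n (4 u\<^sup>2 + 1)\<close>. If \<open>u\<close> exceeds
  \<open>B = net_const\<close>, then \<open>(u / B)\<^sup>2\<^sup>N \<le> (u / B)\<^sup>n \<le> exp (n u) / B\<^sup>n\<close>, and \<open>B\<close> is so large that the sum of
  these exponentials over the net has expectation at most 1.\<close>
lemma op_bounded_centered_kron_gauss:
  assumes i: "i < n" and N: "2 * N \<le> n"
  obtains z where "0 \<le> z" "op_bounded (pairs n) (centered_kron T i) z"
    "z ^ N \<le> (8 * net_const\<^sup>2 * n) ^ N * (1 + net_exp_sum n T i)"
proof -
  have n: "n > 0" using i by simp
  let ?V = "(\<lambda>(z, z'). netform n T i z z') ` (netpts n \<times> netpts n)"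
  define \<tau> where "\<tau> = Max ?V"
  have fin: "finite ?V" by simp
  have z0: "(\<lambda>a\<in>{..<n}. 0) \<in> netpts n" by (simp add: netpts_def)
  then have mem: "netform n T i (\<lambda>a\<in>{..<n}. 0) (\<lambda>a\<in>{..<n}. 0) \<in> ?V" by auto
  moreover have "netform n T i (\<lambda>a\<in>{..<n}. 0) (\<lambda>a\<in>{..<n}. 0) = 0" by (simp add: netform_def)
  ultimately have \<tau>0: "0 \<le> \<tau>" using Max_ge[OF fin mem] by (simp add: \<tau>_def)
  have "\<tau> \<in> ?V" unfolding \<tau>_def by (rule Max_in[OF fin]) (use mem in blast)
  then obtain z z' where z: "z \<in> netpts n" "z' \<in> netpts n" "\<tau> = netform n T i z z'" by auto
  have "netform n T i z z' \<le> \<tau>" if "z \<in> netpts n" "z' \<in> netpts n" for z z'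
    unfolding \<tau>_def by (rule Max_ge[OF fin]) (use that in auto)
  then have "op_bounded {..<n} (\<lambda>a c. T (i, a, c)) (2 * \<tau>)"
    using n by (intro op_bounded_of_net) (auto simp: netform_def)
  from op_bounded_centered_kron[OF _ this] \<tau>0
  have bd: "op_bounded (pairs n) (centered_kron T i) ((2 * \<tau>)\<^sup>2 + n)"
    by (simp add: centered_kron_def[abs_def])
  define u where "u = \<tau> / sqrt n"
  have u: "0 \<le> u" "\<tau>\<^sup>2 = n * u\<^sup>2" "sqrt n * \<tau> = n * u"
    using n \<tau>0 by (auto simp: u_def power_divide) (metis real_div_sqrt times_divide_eq_left mult.commute of_nat_0_le_iff)
  have eq: "(2 * \<tau>)\<^sup>2 + n = n * (4 * u\<^sup>2 + 1)"
    by (simp add: power_mult_distrib u algebra_simps)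
  have B: "net_const \<ge> 1" by (rule net_const_ge_1)
  have "((2 * \<tau>)\<^sup>2 + n) ^ N \<le> (8 * net_const\<^sup>2 * n) ^ N * (1 + net_exp_sum n T i)"
  proof (cases "u \<le> net_const")
    case True
    have "u\<^sup>2 \<le> net_const\<^sup>2" "1 \<le> net_const\<^sup>2" using True u B by (auto intro: power_mono)
    then have "n * (4 * u\<^sup>2 + 1) \<le> n * (8 * net_const\<^sup>2)" by (intro mult_left_mono) auto
    then have "((2 * \<tau>)\<^sup>2 + n) ^ N \<le> (8 * net_const\<^sup>2 * n) ^ N * 1"
      unfolding eq by (simp add: mult_ac) (intro power_mono, auto)
    also have "\<dots> \<le> (8 * net_const\<^sup>2 * n) ^ N * (1 + net_exp_sum n T i)"
      by (intro mult_left_mono) (auto simp: net_exp_sum_nonneg)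
    finally show ?thesis .
  next
    case False
    have u1: "u \<ge> 1" using False B by simp
    have ub: "u / net_const \<ge> 1" using False B by simp
    have "1 \<le> u\<^sup>2" using u1 by simp
    then have "n * (4 * u\<^sup>2 + 1) \<le> n * (8 * u\<^sup>2)" by (intro mult_left_mono) auto
    also have "\<dots> = (8 * net_const\<^sup>2 * n) * (u / net_const)\<^sup>2"
      using B by (simp add: power_divide)
    finally have "((2 * \<tau>)\<^sup>2 + n) ^ N \<le> ((8 * net_const\<^sup>2 * n) * (u / net_const)\<^sup>2) ^ N"
      unfolding eq using n by (intro power_mono) auto
    also have "\<dots> = (8 * net_const\<^sup>2 * n) ^ N * (u / net_const) ^ (2 * N)"
      by (simp only: power_mult_distrib power_mult)
    also have "\<dots> \<le> (8 * net_const\<^sup>2 * n) ^ N * (u / net_const) ^ n"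
      using ub N by (intro mult_left_mono power_increasing) auto
    also have "\<dots> \<le> (8 * net_const\<^sup>2 * n) ^ N * net_exp_sum n T i"
    proof (intro mult_left_mono)
      have "u ^ n \<le> exp u ^ n" using u exp_ge_add_one_self[of u] by (intro power_mono) linarith+
      also have "\<dots> = exp (sqrt n * netform n T i z z')"
        using u z by (simp add: exp_of_nat_mult[symmetric])
      also have "\<dots> \<le> (\<Sum>z'\<in>netpts n. exp (sqrt n * netform n T i z z'))"
        using z by (intro member_le_sum) auto
      also have "\<dots> \<le> (\<Sum>z\<in>netpts n. \<Sum>z'\<in>netpts n. exp (sqrt n * netform n T i z z'))"
        using z by (intro member_le_sum[of z _ "\<lambda>z. \<Sum>z'\<in>netpts n. exp (sqrt n * netform n T i z z')"])
          (auto intro: sum_nonneg)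
      finally show "(u / net_const) ^ n \<le> net_exp_sum n T i"
        unfolding net_exp_sum_def power_divide using B by (intro divide_right_mono) auto
    qed (use B in auto)
    also have "\<dots> \<le> (8 * net_const\<^sup>2 * n) ^ N * (1 + net_exp_sum n T i)"
      by (intro mult_left_mono) auto
    finally show ?thesis .
  qed
  moreover have "0 \<le> (2 * \<tau>)\<^sup>2 + n" by simp
  ultimately show ?thesis using bd that by blast
qed

section \<open>Expected trace powers\<close>

text \<open>A single term of the exponential series is at most the whole series.\<close>

lemma power_le_fact_mult_exp:
  fixes x :: real
  assumes "0 \<le> x"
  shows "x ^ N \<le> fact N * exp x"
proof -
  have "(\<Sum>k\<in>{N}. inverse (fact k) *\<^sub>R x ^ k) \<le> exp x"
    unfolding exp_def using assms by (intro sum_le_suminf summable_exp_generic) auto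
  then show ?thesis by (simp add: field_simps)
qed

lemma exp_le_quadratic:
  fixes x :: real
  assumes "\<bar>x\<bar> \<le> 1"
  shows "exp x \<le> 1 + x + x\<^sup>2"
proof (cases "x \<ge> 0")
  case True
  then show ?thesis using assms by (intro exp_bound) auto
next
  case False
  define y where "y = - x"
  have y: "0 \<le> y" using False by (simp add: y_def)
  \<comment> \<open>Since exp y \<ge> 1 + y, it is enough that 1 - y + y^2 is at least 1 / (1 +
    y).\<close>
  have "(1 - y + y\<^sup>2) * (1 + y) = 1 + y ^ 3" by algebra
  then have "1 \<le> (1 - y + y\<^sup>2) * (1 + y)" using y by simp
  also have "\<dots> \<le> (1 - y + y\<^sup>2) * exp y"
  proof (intro mult_left_mono)
    have "0 \<le> (1 - y / 2)\<^sup>2 + 3 / 4 * y\<^sup>2" by simp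
    also have "\<dots> = 1 - y + y\<^sup>2" by (simp add: power2_eq_square field_simps)
    finally show "0 \<le> 1 - y + y\<^sup>2" .
  qed simp
  finally have "exp (- y) \<le> 1 - y + y\<^sup>2" by (simp add: exp_minus field_simps)
  then show ?thesis by (simp add: y_def)
qed

lemma prod_list_map_count:
  fixes f :: "'i \<Rightarrow> 'b :: comm_monoid_mult"
  assumes "finite I" "set w \<subseteq> I"
  shows "prod_list (map f w) = (\<Prod>i\<in>I. f i ^ count_list w i)"
  using assms(2)
proof (induction w)
  case (Cons j w)
  have "(\<Prod>i\<in>I. f i ^ count_list (j # w) i) = (\<Prod>i\<in>I. (if i = j then f i else 1) * f i ^ count_list w i)"
    by (intro prod.cong refl) auto
  also have "\<dots> = f j * (\<Prod>i\<in>I. f i ^ count_list w i)"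
    using Cons.prems assms(1) by (simp add: prod.distrib)
  finally show ?case using Cons by simp
qed simp

text \<open>Only single occurrences are excluded: a letter may appear three times or more, and it
  need not appear an even number of times.\<close>

definition paired_words :: "'i set \<Rightarrow> nat \<Rightarrow> 'i list set" where
  "paired_words I N = {w \<in> words I N. \<forall>i. count_list w i \<noteq> 1}"

text \<open>Let \<open>\<sigma>\<close> take the values 2 and \<open>-1\<close> with probabilities 1/3 and 2/3. Its mean is 0
  and all its moments of order at least 2 are at least 1, so that the \<open>N\<close>-th moment of a sum of
  independent copies, expanded into words, dominates the number of paired words.\<close>
lemma card_paired_words:
  fixes I :: "'i set"
  assumes I: "finite I" "card I = n" and N: "1 \<le> N" "N \<le> n" "even N"
  shows "real (card (paired_words I N)) \<le> 2 * (2 * exp 1 * sqrt (n * N)) ^ N"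
proof -
  define \<rho> where "\<rho> s = (if s = 2 then 1/3 else 2/3 :: real)" for s :: real
  define \<Omega> where "\<Omega> = I \<rightarrow>\<^sub>E {2, -1 :: real}"
  define Ex where "Ex f = (\<Sum>\<sigma>\<in>\<Omega>. (\<Prod>i\<in>I. \<rho> (\<sigma> i)) * f \<sigma>)" for f :: "('i \<Rightarrow> real) \<Rightarrow> real"
  have Ex_prod: "Ex (\<lambda>\<sigma>. \<Prod>i\<in>I. g i (\<sigma> i)) = (\<Prod>i\<in>I. 1/3 * g i 2 + 2/3 * g i (-1))" for g
  proof -
    have "(\<Prod>i\<in>I. 1/3 * g i 2 + 2/3 * g i (-1)) = (\<Prod>i\<in>I. \<Sum>s\<in>{2, -1}. \<rho> s * g i s)"
      by (simp add: \<rho>_def)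
    also have "\<dots> = (\<Sum>\<sigma>\<in>\<Omega>. \<Prod>i\<in>I. \<rho> (\<sigma> i) * g i (\<sigma> i))"
      unfolding \<Omega>_def using I by (intro prod_sum_PiE) auto
    finally show ?thesis by (simp add: Ex_def prod.distrib)
  qed
  have Ex_mono: "Ex f \<le> Ex g" if "\<And>\<sigma>. f \<sigma> \<le> g \<sigma>" for f g
    unfolding Ex_def using that by (intro sum_mono mult_left_mono prod_nonneg) (auto simp: \<rho>_def)
  define m :: "nat \<Rightarrow> real" where "m c = 1/3 * 2 ^ c + 2/3 * (-1) ^ c" for c
  have m1: "m c \<ge> 1" if "c \<noteq> 1" for c
  proof (cases "c = 0")
    case False
    then have "c \<ge> 2" using that by simp
    show ?thesis
    proof (cases "even c")
      case True
      have "(2::real) ^ c \<ge> 2 ^ 2" using \<open>c \<ge> 2\<close> by (intro power_increasing) auto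
      then show ?thesis using True by (simp add: m_def)
    next
      case odd: False
      then have "c \<ge> 3" using \<open>c \<ge> 2\<close> by (cases "c = 2") auto
      then have "(2::real) ^ c \<ge> 2 ^ 3" by (intro power_increasing) auto
      then show ?thesis using odd by (simp add: m_def)
    qed
  qed (simp add: m_def)
  have m0: "m c \<ge> 0" for c
    using m1[of c] by (cases "c = 1") (auto simp: m_def)
  have "real (card (paired_words I N)) = (\<Sum>w\<in>paired_words I N. 1)" by simp
  also have "\<dots> \<le> (\<Sum>w\<in>paired_words I N. \<Prod>i\<in>I. m (count_list w i))"
    by (intro sum_mono prod_ge_1 m1) (auto simp: paired_words_def)
  also have "\<dots> \<le> (\<Sum>w\<in>words I N. \<Prod>i\<in>I. m (count_list w i))"
    using I by (intro sum_mono2) (auto simp: paired_words_def intro!: prod_nonneg m0)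
  also have "\<dots> = (\<Sum>w\<in>words I N. Ex (\<lambda>\<sigma>. prod_list (map \<sigma> w)))"
  proof (intro sum.cong refl)
    fix w assume "w \<in> words I N"
    then have "set w \<subseteq> I" by (simp add: words_def)
    from prod_list_map_count[OF I(1) this, where 'b = real]
    show "(\<Prod>i\<in>I. m (count_list w i)) = Ex (\<lambda>\<sigma>. prod_list (map \<sigma> w))"
      using Ex_prod[of "\<lambda>i s. s ^ count_list w i"] by (simp add: m_def)
  qed
  also have "\<dots> = Ex (\<lambda>\<sigma>. (\<Sum>i\<in>I. \<sigma> i) ^ N)"
    unfolding Ex_def power_sum_words sum_distrib_left by (rule sum.swap)
  also have "\<dots> \<le> 2 * (2 * exp 1 * sqrt (n * N)) ^ N"
  proof -
    \<comment> \<open>Chosen so that n * 4 \<theta>^2 = N: the exponential moment is then at most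
      exp N, a constant to the power N. The assumption N \<le> n gives \<theta> \<le> 1/2, which
      keeps the exponent 2 \<theta> in the range of \<open>exp_le_quadratic\<close>.\<close>
    define \<theta> where "\<theta> = sqrt (N / n) / 2"
    have n: "n > 0" using N by simp
    have \<theta>: "0 < \<theta>" "\<theta> \<le> 1/2" "4 * \<theta>\<^sup>2 = N / n"
      using N n by (auto simp: \<theta>_def power_divide)
    \<comment> \<open>Evenness of N replaces the sum by its absolute value, and the exponential of
      an absolute value is at most the sum of the two one-sided exponentials, each of which
      factorises over I.\<close>
    have pt: "(\<Sum>i\<in>I. \<sigma> i) ^ N \<le> fact N / \<theta> ^ N * ((\<Prod>i\<in>I. exp (\<theta> * \<sigma> i)) + (\<Prod>i\<in>I. exp (- \<theta> * \<sigma> i)))"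
      for \<sigma> :: "'i \<Rightarrow> real"
    proof -
      let ?S = "\<Sum>i\<in>I. \<sigma> i"
      have "\<theta> ^ N * ?S ^ N = (\<theta> * \<bar>?S\<bar>) ^ N"
        using N by (simp add: power_mult_distrib power_even_abs)
      also have "\<dots> \<le> fact N * exp (\<theta> * \<bar>?S\<bar>)"
        using \<theta> by (intro power_le_fact_mult_exp) auto
      also have "\<dots> \<le> fact N * (exp (\<theta> * ?S) + exp (- \<theta> * ?S))"
        by (intro mult_left_mono) (auto simp: abs_if)
      also have "\<dots> = fact N * ((\<Prod>i\<in>I. exp (\<theta> * \<sigma> i)) + (\<Prod>i\<in>I. exp (- \<theta> * \<sigma> i)))"
        using I by (simp only: exp_sum sum_distrib_left)
      finally show ?thesis using \<theta> by (simp add: field_simps)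
    qed
    have mgf: "Ex (\<lambda>\<sigma>. \<Prod>i\<in>I. exp (a * \<sigma> i)) \<le> exp N" if "\<bar>a\<bar> = \<theta>" for a
    proof -
      have "Ex (\<lambda>\<sigma>. \<Prod>i\<in>I. exp (a * \<sigma> i)) = (\<Prod>i\<in>I. 1/3 * exp (a * 2) + 2/3 * exp (a * (-1)))"
        by (rule Ex_prod)
      also have "\<dots> \<le> (\<Prod>i\<in>I. exp (4 * \<theta>\<^sup>2))"
      proof (intro prod_mono conjI)
        have sq: "a\<^sup>2 = \<theta>\<^sup>2" using that by (metis power2_abs)
        have "exp (a * 2) \<le> 1 + a * 2 + (a * 2)\<^sup>2" "exp (a * (-1)) \<le> 1 + a * (-1) + (a * (-1))\<^sup>2"
          by (rule exp_le_quadratic, use that \<theta> in \<open>simp add: abs_mult\<close>)+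
        \<comment> \<open>The linear terms cancel because the mean is 0; the second moment (4 + 2 *
          1) / 3 = 2 remains.\<close>
        then have "1/3 * exp (a * 2) + 2/3 * exp (a * (-1)) \<le> 1 + 2 * \<theta>\<^sup>2"
          by (simp add: power_mult_distrib sq)
        also have "\<dots> \<le> 1 + 4 * \<theta>\<^sup>2" by simp
        also have "\<dots> \<le> exp (4 * \<theta>\<^sup>2)" by (rule exp_ge_add_one_self)
        finally show "1/3 * exp (a * 2) + 2/3 * exp (a * (-1)) \<le> exp (4 * \<theta>\<^sup>2)" .
      qed (simp add: add_nonneg_nonneg)
      also have "\<dots> = exp (real n * (N / n))"
        unfolding \<theta>(3) prod_constant I(2) by (rule exp_of_nat_mult[symmetric])
      also have "\<dots> = exp N" using n by simp
      finally show ?thesis .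
    qed
    have "Ex (\<lambda>\<sigma>. (\<Sum>i\<in>I. \<sigma> i) ^ N)
       \<le> Ex (\<lambda>\<sigma>. fact N / \<theta> ^ N * ((\<Prod>i\<in>I. exp (\<theta> * \<sigma> i)) + (\<Prod>i\<in>I. exp (- \<theta> * \<sigma> i))))"
      by (intro Ex_mono pt)
    also have "\<dots> = fact N / \<theta> ^ N * (Ex (\<lambda>\<sigma>. \<Prod>i\<in>I. exp (\<theta> * \<sigma> i)) + Ex (\<lambda>\<sigma>. \<Prod>i\<in>I. exp (- \<theta> * \<sigma> i)))"
      unfolding Ex_def sum.distrib[symmetric] sum_distrib_left
      by (intro sum.cong refl) (simp add: algebra_simps)
    also have "\<dots> \<le> fact N / \<theta> ^ N * (exp N + exp N)"
      using \<theta> by (intro mult_left_mono add_mono mgf) auto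
    also have "\<dots> \<le> N ^ N / \<theta> ^ N * (exp N + exp N)"
      using \<theta> fact_le_power[of N, where 'a = real] by (intro mult_right_mono divide_right_mono) (auto simp: add_nonneg_nonneg)
    also have "\<dots> = 2 * (N / \<theta> * exp 1) ^ N"
      by (simp add: power_mult_distrib power_divide exp_of_nat_mult[symmetric])
    also have "N / \<theta> = 2 * sqrt (n * N)"
    proof -
      have "real N = sqrt N * sqrt N" by simp
      then have "N / \<theta> = 2 * (sqrt N * sqrt N) * sqrt n / sqrt N"
        by (simp add: \<theta>_def real_sqrt_divide)
      also have "\<dots> = 2 * sqrt (n * N)"
      proof -
        have "2 * (x * x) * y / x = 2 * (y * x)" if "x \<noteq> 0" for x y :: real
          using that by simp
        from this[of "sqrt N" "sqrt n"] show ?thesis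
          unfolding of_nat_mult real_sqrt_mult using N by fastforce
      qed
      finally show ?thesis .
    qed
    finally show ?thesis by (simp add: mult_ac)
  qed
  finally show ?thesis .
qed

text \<open>The product is at most the N-th power of its largest factor, and that power is one term
  of the sum. The right-hand side no longer depends on the word, so moments of single letters
  suffice.\<close>

lemma prod_list_le_sum_power:
  fixes z :: "'i \<Rightarrow> real"
  assumes "finite I" "w \<in> words I N" "N \<ge> 1" and z: "\<And>i. i \<in> I \<Longrightarrow> 0 \<le> z i"
  shows "prod_list (map z w) \<le> (\<Sum>i\<in>I. z i ^ N)"
proof -
  have w: "set w \<subseteq> I" "length w = N" "w \<noteq> []" using assms by (auto simp: words_def)
  have le: "prod_list (map z v) \<le> m ^ length v" if "\<And>i. i \<in> set v \<Longrightarrow> 0 \<le> z i \<and> z i \<le> m" for m v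
    using that
  proof (induction v)
    case (Cons j v)
    have "0 \<le> prod_list (map z v)" using Cons.prems by (intro prod_list_nonneg) auto
    moreover have "0 \<le> m" using Cons.prems[of j] by simp
    ultimately show ?case using Cons by (auto intro!: mult_mono)
  qed simp
  obtain j where j: "j \<in> set w" "z j = Max (z ` set w)"
    using Max_in[of "z ` set w"] w by fastforce
  have "prod_list (map z w) \<le> z j ^ length w"
    by (rule le) (use j w z in auto)
  also have "\<dots> \<le> (\<Sum>i\<in>I. z i ^ N)"
    unfolding w(2) using j w assms by (intro member_le_sum zero_le_power) auto
  finally show ?thesis .
qed

section \<open>Moments of the trace for a fixed exponent N\<close>

context
  fixes n N :: nat
  assumes N: "1 \<le> N" "2 * N \<le> n"
begin

text \<open>One integrable function of the tensor that dominates the norm products of all words of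
  length N at once.\<close>

definition wbound :: "(nat \<times> nat \<times> nat \<Rightarrow> real) \<Rightarrow> real" where
  "wbound T = (\<Sum>i<n. (8 * net_const\<^sup>2 * n) ^ N * (1 + net_exp_sum n T i))"

lemma wbound: "integrable (gauss_tensor n) wbound"
  "(\<integral>T. wbound T \<partial>gauss_tensor n) \<le> 2 * n * (8 * net_const\<^sup>2 * n) ^ N"
proof -
  interpret prob_space "gauss_tensor n" by (rule prob_space_gauss_tensor)
  show "integrable (gauss_tensor n) wbound"
    unfolding wbound_def[abs_def] using integrable_net_exp_sum
    by (intro Bochner_Integration.integrable_sum integrable_mult_right Bochner_Integration.integrable_add) auto
  have "(\<integral>T. wbound T \<partial>gauss_tensor n)
     = (\<Sum>i<n. (8 * net_const\<^sup>2 * n) ^ N * (1 + (\<integral>T. net_exp_sum n T i \<partial>gauss_tensor n)))"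
    unfolding wbound_def using integrable_net_exp_sum
    by (subst Bochner_Integration.integral_sum) (auto simp: prob_space)
  also have "\<dots> \<le> (\<Sum>i<n. (8 * net_const\<^sup>2 * n) ^ N * 2)"
    using integrable_net_exp_sum(2) by (intro sum_mono mult_left_mono) force+
  finally show "(\<integral>T. wbound T \<partial>gauss_tensor n) \<le> 2 * n * (8 * net_const\<^sup>2 * n) ^ N"
    by (simp add: mult_ac)
qed

text \<open>The bounds \<open>z\<close> are chosen separately for each T, with no measurability;
  only \<open>wbound\<close> is ever integrated. The bounds for \<open>centered_kron\<close> are
  kept beside those for \<open>sym_kron\<close> because the cancellation argument works with the
  unsymmetrised entries.\<close>

lemma wbound_dominates:
  obtains z where "\<And>i. i < n \<Longrightarrow> 0 \<le> z i"
    "\<And>i. i < n \<Longrightarrow> op_bounded (pairs n) (centered_kron T i) (z i)" "\<And>i. i < n \<Longrightarrow> op_bounded (pairs n) (sym_kron T i) (z i)"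
    "\<And>w. w \<in> words {..<n} N \<Longrightarrow> prod_list (map z w) \<le> wbound T"
proof -
  have "\<exists>z. i < n \<longrightarrow> 0 \<le> z \<and> op_bounded (pairs n) (centered_kron T i) z \<and>
      z ^ N \<le> (8 * net_const\<^sup>2 * n) ^ N * (1 + net_exp_sum n T i)" for i
  proof (cases "i < n")
    case True
    obtain z where "0 \<le> z" "op_bounded (pairs n) (centered_kron T i) z" "z ^ N \<le> (8 * net_const\<^sup>2 * n) ^ N * (1 + net_exp_sum n T i)"
      by (rule op_bounded_centered_kron_gauss[OF True N(2)])
    then show ?thesis by blast
  qed simp
  then obtain z where "\<forall>i. i < n \<longrightarrow> 0 \<le> z i \<and> op_bounded (pairs n) (centered_kron T i) (z i) \<and>
      z i ^ N \<le> (8 * net_const\<^sup>2 * n) ^ N * (1 + net_exp_sum n T i)"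
    using choice[of "\<lambda>i z. i < n \<longrightarrow> 0 \<le> z \<and> op_bounded (pairs n) (centered_kron T i) z \<and>
      z ^ N \<le> (8 * net_const\<^sup>2 * n) ^ N * (1 + net_exp_sum n T i)"] by blast
  then have z: "\<And>i. i < n \<Longrightarrow> 0 \<le> z i \<and> op_bounded (pairs n) (centered_kron T i) (z i) \<and>
      z i ^ N \<le> (8 * net_const\<^sup>2 * n) ^ N * (1 + net_exp_sum n T i)"
    by blast
  show ?thesis
  proof (rule that)
    fix i assume i: "i < n"
    show "0 \<le> z i" using z[OF i] by simp
    show bd: "op_bounded (pairs n) (centered_kron T i) (z i)" using z[OF i] by simp
    show "op_bounded (pairs n) (sym_kron T i) (z i)"
      unfolding sym_kron_def[abs_def] by (rule op_bounded_average[OF bd op_bounded_transpose[OF bd]])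
  next
    fix w assume w: "w \<in> words {..<n} N"
    have "prod_list (map z w) \<le> (\<Sum>i<n. z i ^ N)"
    proof (rule prod_list_le_sum_power[OF finite_lessThan w N(1)])
      fix i assume "i \<in> {..<n}"
      then show "0 \<le> z i" using z[of i] by simp
    qed
    also have "\<dots> \<le> wbound T"
      unfolding wbound_def
    proof (rule sum_mono)
      fix i assume "i \<in> {..<n}"
      then show "z i ^ N \<le> (8 * net_const\<^sup>2 * n) ^ N * (1 + net_exp_sum n T i)" using z[of i] by simp
    qed
    finally show "prod_list (map z w) \<le> wbound T" .
  qed
qed

lemma centered_kron_measurable:
  assumes "i < n" "p \<in> pairs n" "q \<in> pairs n"
  shows "(\<lambda>T. centered_kron T i p q) \<in> borel_measurable (gauss_tensor n)"
proof -
  have [measurable]: "(\<lambda>T. T (i, fst p, fst q)) \<in> borel_measurable (gauss_tensor n)"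
    "(\<lambda>T. T (i, snd p, snd q)) \<in> borel_measurable (gauss_tensor n)"
    using assms by (auto intro: gauss_tensor_component)
  show ?thesis unfolding centered_kron_def by measurable
qed

lemma wordact_measurable:
  assumes "set w \<subseteq> {..<n}" "p \<in> pairs n"
  shows "(\<lambda>T. wordact (pairs n) (sym_kron T) w v p) \<in> borel_measurable (gauss_tensor n)"
  using assms
proof (induction w arbitrary: p)
  case (Cons i w)
  have "(\<lambda>T. sym_kron T i p q) \<in> borel_measurable (gauss_tensor n)" if "q \<in> pairs n" for q
    unfolding sym_kron_def using centered_kron_measurable[of i] Cons.prems that
    by (intro borel_measurable_divide borel_measurable_add) auto
  then show ?case unfolding wordact_Cons using Cons
    by (intro borel_measurable_sum borel_measurable_times) auto
qed simp

lemma
  assumes w: "w \<in> words {..<n} N" and p: "p \<in> pairs n"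
  shows integrable_wordact: "integrable (gauss_tensor n) (\<lambda>T. wordact (pairs n) (sym_kron T) w (unitv p) p)"
    and integral_wordact_le:
      "(\<integral>T. wordact (pairs n) (sym_kron T) w (unitv p) p \<partial>gauss_tensor n) \<le> 2 * n * (8 * net_const\<^sup>2 * n) ^ N"
proof -
  have ws: "set w \<subseteq> {..<n}" using w by (simp add: words_def)
  have le: "\<bar>wordact (pairs n) (sym_kron T) w (unitv p) p\<bar> \<le> wbound T" for T
  proof -
    obtain z where z: "\<And>i. i < n \<Longrightarrow> 0 \<le> z i"
      "\<And>i. i < n \<Longrightarrow> op_bounded (pairs n) (centered_kron T i) (z i)" "\<And>i. i < n \<Longrightarrow> op_bounded (pairs n) (sym_kron T i) (z i)"
      "\<And>w. w \<in> words {..<n} N \<Longrightarrow> prod_list (map z w) \<le> wbound T"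
      by (rule wbound_dominates[of T]) blast
    have "\<bar>wordact (pairs n) (sym_kron T) w (unitv p) p\<bar> \<le> prod_list (map z w)"
      using ws p z by (intro wordact_entry_le) auto
    then show ?thesis using z(4)[OF w] by simp
  qed
  show int: "integrable (gauss_tensor n) (\<lambda>T. wordact (pairs n) (sym_kron T) w (unitv p) p)"
    by (rule Bochner_Integration.integrable_bound[OF wbound(1) wordact_measurable[OF ws p]])
      (use le in \<open>auto intro!: AE_I2 order_trans[OF _ abs_ge_self]\<close>)
  have "(\<integral>T. wordact (pairs n) (sym_kron T) w (unitv p) p \<partial>gauss_tensor n) \<le> (\<integral>T. wbound T \<partial>gauss_tensor n)"
    using int wbound(1) le by (intro integral_mono) (auto simp: abs_le_iff)
  with wbound(2) show "(\<integral>T. wordact (pairs n) (sym_kron T) w (unitv p) p \<partial>gauss_tensor n) \<le> 2 * n * (8 * net_const\<^sup>2 * n) ^ N"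
    by linarith
qed

text \<open>The two factors of an entry are the same coordinate exactly when
  \<open>cup_matrix p q\<close> is 1, and then the entry is y^2 - 1; otherwise it is linear in y.
  Either way its mean over this one coordinate is 0, whatever the other coordinates are.\<close>

lemma centered_kron_update_integral:
  assumes "p \<in> pairs n" "q \<in> pairs n"
  shows "(\<integral>y. centered_kron (T((i, fst p, fst q) := y)) i p q \<partial>std_normal_distribution) = 0"
proof (cases "fst p = snd p \<and> fst q = snd q")
  case True
  interpret prob_space std_normal_distribution by (rule prob_space_normal_density) simp
  have "centered_kron (T((i, fst p, fst q) := y)) i p q = y\<^sup>2 - 1" for y
    using True by (simp add: centered_kron_def cup_matrix_def power2_eq_square)
  then show ?thesis using gauss_moments by (simp add: Bochner_Integration.integral_diff prob_space[simplified])
next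
  case False
  then have "centered_kron (T((i, fst p, fst q) := y)) i p q = y * T (i, snd p, snd q)" for y
    by (auto simp: centered_kron_def cup_matrix_def)
  then show ?thesis using gauss_moments by simp
qed

lemma wordact_update:
  assumes "i \<notin> set w"
  shows "wordact (pairs n) (sym_kron (T((i, b) := y))) w v = wordact (pairs n) (sym_kron T) w v"
proof -
  have "sym_kron (T((i, b) := y)) j = sym_kron T j" if "j \<noteq> i" for j
    using that by (auto simp: sym_kron_def centered_kron_def fun_eq_iff)
  with assms show ?thesis by (induction w) auto
qed

text \<open>Splitting at the single letter i leaves a prefix and a suffix that do not involve the
  entries with first index i. Every term of the resulting sum is thus a centred entry times a factor
  that is constant in the coordinate being integrated.\<close>

lemma integral_wordact_single:
  assumes w: "w \<in> words {..<n} N" and p: "p \<in> pairs n" and single: "count_list w i = 1"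
  shows "(\<integral>T. wordact (pairs n) (sym_kron T) w (unitv p) p \<partial>gauss_tensor n) = 0"
proof -
  have "i \<in> set w" using single by (metis count_notin zero_neq_one)
  then obtain w1 w2 where w12: "w = w1 @ i # w2" "i \<notin> set w1" by (meson split_list_first)
  with single have i2: "i \<notin> set w2" by (simp add: count_list_0_iff)
  have ws: "set w1 \<subseteq> {..<n}" "set w2 \<subseteq> {..<n}" "i < n" "set w \<subseteq> {..<n}"
    using w by (auto simp: w12 words_def)
  define F where "F T q = wordact (pairs n) (sym_kron T) w1 (unitv q) p" for T q
  define H where "H T r = wordact (pairs n) (sym_kron T) w2 (unitv p) r" for T r
  have zero: "integrable (gauss_tensor n) (\<lambda>T. F T q * centered_kron T i q' r' * H T r) \<and>
      (\<integral>T. F T q * centered_kron T i q' r' * H T r \<partial>gauss_tensor n) = 0"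
    if "q \<in> pairs n" "r \<in> pairs n" "q' \<in> pairs n" "r' \<in> pairs n" for q r q' r'
  proof -
    \<comment> \<open>Splitting the integral into terms needs each term to be integrable. Prefix,
      entry and suffix together have the norm product of the full word, so the same function
      dominates.\<close>
    have le: "\<bar>F T q * centered_kron T i q' r' * H T r\<bar> \<le> wbound T" for T
    proof -
      obtain z where z: "\<And>i. i < n \<Longrightarrow> 0 \<le> z i"
        "\<And>i. i < n \<Longrightarrow> op_bounded (pairs n) (centered_kron T i) (z i)" "\<And>i. i < n \<Longrightarrow> op_bounded (pairs n) (sym_kron T i) (z i)"
        "\<And>w. w \<in> words {..<n} N \<Longrightarrow> prod_list (map z w) \<le> wbound T"
        by (rule wbound_dominates[of T]) blast
      have "\<bar>F T q\<bar> \<le> prod_list (map z w1)" "\<bar>H T r\<bar> \<le> prod_list (map z w2)"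
        unfolding F_def H_def using ws p that z by (auto intro!: wordact_entry_le)
      moreover have "\<bar>centered_kron T i q' r'\<bar> \<le> z i"
        using op_bounded_entry[OF z(2)[OF ws(3)]] that by simp
      ultimately have "\<bar>F T q * centered_kron T i q' r' * H T r\<bar>
          \<le> prod_list (map z w1) * z i * prod_list (map z w2)"
        unfolding abs_mult using ws z by (intro mult_mono mult_nonneg_nonneg prod_list_nonneg) auto
      also have "\<dots> \<le> wbound T" using z(4)[OF w] by (simp add: w12 mult_ac)
      finally show ?thesis .
    qed
    have meas: "(\<lambda>T. F T q * centered_kron T i q' r' * H T r) \<in> borel_measurable (gauss_tensor n)"
      unfolding F_def H_def using ws p that
      by (intro borel_measurable_times wordact_measurable centered_kron_measurable) auto
    have int: "integrable (gauss_tensor n) (\<lambda>T. F T q * centered_kron T i q' r' * H T r)"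
      by (rule Bochner_Integration.integrable_bound[OF wbound(1) meas])
        (use le in \<open>auto intro!: AE_I2 order_trans[OF _ abs_ge_self]\<close>)
    \<comment> \<open>The coordinate varies with the term: it is the first of the two tensor entries
      in this particular product.\<close>
    let ?\<alpha> = "(i, fst q', fst r')"
    have "(\<integral>y. F (T(?\<alpha> := y)) q * centered_kron (T(?\<alpha> := y)) i q' r' * H (T(?\<alpha> := y)) r \<partial>std_normal_distribution) = 0" for T
      unfolding F_def H_def wordact_update[OF w12(2)] wordact_update[OF i2]
      using centered_kron_update_integral[OF that(3,4), of T i] by simp
    then have "(\<integral>T. F T q * centered_kron T i q' r' * H T r \<partial>gauss_tensor n) = 0"
      using int that ws unfolding gauss_tensor_def
      by (intro integral_zero_coordinate[of _ ?\<alpha>]) auto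
    with int show ?thesis by simp
  qed
  have "wordact (pairs n) (sym_kron T) w (unitv p) p
      = (\<Sum>q\<in>pairs n. \<Sum>r\<in>pairs n. (F T q * centered_kron T i q r * H T r + F T q * centered_kron T i r q * H T r) / 2)" for T
    unfolding w12(1) F_def H_def using p
    by (subst wordact_split) (auto intro!: sum.cong simp: sym_kron_def field_simps)
  moreover have "(\<integral>T. (\<Sum>q\<in>pairs n. \<Sum>r\<in>pairs n. (F T q * centered_kron T i q r * H T r + F T q * centered_kron T i r q * H T r) / 2) \<partial>gauss_tensor n)
    = (\<Sum>q\<in>pairs n. \<Sum>r\<in>pairs n. ((\<integral>T. F T q * centered_kron T i q r * H T r \<partial>gauss_tensor n)
        + (\<integral>T. F T q * centered_kron T i r q * H T r \<partial>gauss_tensor n)) / 2)"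
    using zero
    by (subst Bochner_Integration.integral_sum, (intro Bochner_Integration.integrable_sum integrable_divide Bochner_Integration.integrable_add; simp),
        intro sum.cong refl,
        subst Bochner_Integration.integral_sum, (intro Bochner_Integration.integrable_sum integrable_divide Bochner_Integration.integrable_add; simp),
        intro sum.cong refl,
        subst integral_divide_zero, subst Bochner_Integration.integral_add, simp_all)
  ultimately show ?thesis using zero by simp
qed

definition trace_power :: "(nat \<times> nat \<times> nat \<Rightarrow> real) \<Rightarrow> real" where
  "trace_power T = (\<Sum>p\<in>pairs n. (matvec (pairs n) (\<lambda>p q. \<Sum>i<n. sym_kron T i p q) ^^ N) (unitv p) p)"

lemma trace_power_words: "trace_power T = (\<Sum>p\<in>pairs n. \<Sum>w\<in>words {..<n} N. wordact (pairs n) (sym_kron T) w (unitv p) p)"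
  unfolding trace_power_def by (subst matvec_power_sum) auto

lemma integrable_trace_power: "integrable (gauss_tensor n) trace_power"
  unfolding trace_power_words[abs_def]
  by (intro Bochner_Integration.integrable_sum integrable_wordact)

text \<open>There are n^2 diagonal entries, the surviving words are counted by
  \<open>card_paired_words\<close>, and each contributes at most the mean of \<open>wbound\<close>.
  The polynomial factors n^2, 2 and 2 n combine to 4 n^3.\<close>

lemma integral_trace_power_le:
  assumes "even N"
  shows "(\<integral>T. trace_power T \<partial>gauss_tensor n)
    \<le> 4 * real n ^ 3 * (2 * exp 1 * sqrt (n * N) * (8 * net_const\<^sup>2 * n)) ^ N"
proof -
  let ?R = "(8 * net_const\<^sup>2 * n) ^ N"
  have "(\<integral>T. trace_power T \<partial>gauss_tensor n)
     = (\<Sum>p\<in>pairs n. \<Sum>w\<in>words {..<n} N. \<integral>T. wordact (pairs n) (sym_kron T) w (unitv p) p \<partial>gauss_tensor n)"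
    unfolding trace_power_words
    by (subst Bochner_Integration.integral_sum, intro Bochner_Integration.integrable_sum integrable_wordact, assumption, assumption)
       (intro sum.cong refl Bochner_Integration.integral_sum integrable_wordact)
  also have "\<dots> = (\<Sum>p\<in>pairs n. \<Sum>w\<in>paired_words {..<n} N. \<integral>T. wordact (pairs n) (sym_kron T) w (unitv p) p \<partial>gauss_tensor n)"
    by (intro sum.cong refl sum.mono_neutral_right)
       (auto simp: paired_words_def intro!: integral_wordact_single)
  also have "\<dots> \<le> (\<Sum>p\<in>pairs n. \<Sum>w\<in>paired_words {..<n} N. 2 * n * ?R)"
    by (intro sum_mono integral_wordact_le) (auto simp: paired_words_def)
  also have "\<dots> = n\<^sup>2 * (real (card (paired_words {..<n} N)) * (2 * n * ?R))"
    by (simp add: power2_eq_square)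
  also have "\<dots> \<le> n\<^sup>2 * ((2 * (2 * exp 1 * sqrt (n * N)) ^ N) * (2 * n * ?R))"
    using N assms by (intro mult_left_mono mult_right_mono card_paired_words) auto
  also have "\<dots> = 4 * real n ^ 3 * (2 * exp 1 * sqrt (n * N) * (8 * net_const\<^sup>2 * n)) ^ N"
  proof -
    have "n\<^sup>2 * ((2 * x ^ N) * (2 * n * y ^ N)) = 4 * real n ^ 3 * (x * y) ^ N" for x y :: real
      by (simp add: power_mult_distrib power2_eq_square power3_eq_cube)
    then show ?thesis .
  qed
  finally show ?thesis .
qed

text \<open>\<open>t\<close> is e times the base of the N-th power in the bound for the mean, so
  Markov's inequality leaves exp (-N) beside the polynomial factor.\<close>

lemma trace_power_tail:
  assumes "even N" and t: "t = 2 * (exp 1)\<^sup>2 * sqrt (n * N) * (8 * net_const\<^sup>2 * n)"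
    and nn: "\<And>T. 0 \<le> trace_power T"
  defines "S \<equiv> {T \<in> space (gauss_tensor n). trace_power T \<le> t ^ N}"
  shows "S \<in> sets (gauss_tensor n)" "measure (gauss_tensor n) S \<ge> 1 - 4 * real n ^ 3 * exp (- real N)"
proof -
  interpret prob_space "gauss_tensor n" by (rule prob_space_gauss_tensor)
  have [measurable]: "trace_power \<in> borel_measurable (gauss_tensor n)"
    using integrable_trace_power by (rule borel_measurable_integrable)
  show S: "S \<in> sets (gauss_tensor n)" unfolding S_def by measurable
  let ?a = "2 * exp 1 * sqrt (n * N) * (8 * net_const\<^sup>2 * n)"
  have a: "?a > 0" using N net_const_ge_1 by simp
  have ta: "t = exp 1 * ?a" by (simp add: t power2_eq_square)
  have t0: "t ^ N > 0" using a by (simp add: ta)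
  let ?B = "{T \<in> space (gauss_tensor n). trace_power T \<ge> t ^ N}"
  have "measure (gauss_tensor n) ?B \<le> (\<integral>T. trace_power T \<partial>gauss_tensor n) / t ^ N"
    by (rule integral_Markov_inequality_measure[OF integrable_trace_power sets.top])
      (use nn t0 in auto)
  also have "\<dots> \<le> 4 * real n ^ 3 * ?a ^ N / t ^ N"
    by (intro divide_right_mono integral_trace_power_le assms) (use t0 in simp)
  also have "\<dots> = 4 * real n ^ 3 * exp (- real N)"
  proof -
    have "t ^ N = exp (real N) * ?a ^ N"
      unfolding ta power_mult_distrib[of "exp 1"] by (simp add: exp_of_nat_mult[symmetric])
    moreover have "?a ^ N > 0" using a by (rule zero_less_power)
    moreover have "c * x / (exp y * x) = c * exp (- y)" if "x > 0" for c x y :: real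
      using that by (simp add: exp_minus field_simps)
    ultimately show ?thesis by (simp only:)
  qed
  finally have B: "measure (gauss_tensor n) ?B \<le> 4 * real n ^ 3 * exp (- real N)" .
  have "measure (gauss_tensor n) (space (gauss_tensor n) - S) \<le> measure (gauss_tensor n) ?B"
    by (intro finite_measure_mono) (auto simp: S_def)
  moreover have "measure (gauss_tensor n) (space (gauss_tensor n) - S) = 1 - measure (gauss_tensor n) S"
    by (rule prob_compl[OF S])
  ultimately show "measure (gauss_tensor n) S \<ge> 1 - 4 * real n ^ 3 * exp (- real N)"
    using B by linarith
qed

end

section \<open>Pseudo-expectations\<close>

text \<open>No symmetry is demanded, in agreement with the condition in
  \<open>lambda_bounded\<close>; symmetry is a separate hypothesis where it matters.\<close>

definition psd_on :: "'a set \<Rightarrow> ('a \<Rightarrow> 'a \<Rightarrow> real) \<Rightarrow> bool" where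
  "psd_on S Q \<longleftrightarrow> (\<forall>u. 0 \<le> (\<Sum>p\<in>S. \<Sum>q\<in>S. u p * Q p q * u q))"

lemma sum_insert_symmetric:
  fixes f :: "'a \<Rightarrow> 'a \<Rightarrow> real"
  assumes "finite S" "r \<notin> S" "\<And>p. p \<in> S \<Longrightarrow> f r p = f p r"
  shows "(\<Sum>p\<in>insert r S. \<Sum>q\<in>insert r S. f p q)
    = f r r + 2 * (\<Sum>p\<in>S. f p r) + (\<Sum>p\<in>S. \<Sum>q\<in>S. f p q)"
proof -
  have "(\<Sum>p\<in>S. f r p) = (\<Sum>p\<in>S. f p r)" using assms by (intro sum.cong) auto
  then show ?thesis using assms by (simp add: sum.distrib)
qed

lemma quadratic_nonneg_imp:
  fixes a b c :: real
  assumes "\<And>x. 0 \<le> a * x\<^sup>2 + 2 * b * x + c"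
  shows "b\<^sup>2 \<le> a * c"
proof (cases "a = 0")
  case True
  have "b = 0"
  proof (rule ccontr)
    assume "b \<noteq> 0"
    \<comment> \<open>At this point the affine function 2 b x + c equals -1.\<close>
    then show False using assms[of "- (c + 1) / (2 * b)"] True by (simp add: field_simps)
  qed
  then show ?thesis using True by simp
next
  case False
  have "a > 0"
  proof (rule ccontr)
    assume "\<not> a > 0"
    then have a: "a < 0" using False by simp
    \<comment> \<open>Far enough out that a * x alone outweighs 2 b and still leaves a negative
      slope larger than c in absolute value.\<close>
    define x where "x = (\<bar>2 * b\<bar> + \<bar>c\<bar> + 1) / (- a) + 1"
    have "0 \<le> (\<bar>2 * b\<bar> + \<bar>c\<bar> + 1) / (- a)" using a by (intro divide_nonneg_pos) auto
    then have x: "x \<ge> 1" by (simp add: x_def)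
    have ax: "a * x \<le> - (\<bar>2 * b\<bar> + \<bar>c\<bar> + 1)" using a by (simp add: x_def field_simps)
    have "a * x\<^sup>2 + 2 * b * x + c = (a * x + 2 * b) * x + c" by (simp add: power2_eq_square algebra_simps)
    also have "\<dots> \<le> (- (\<bar>c\<bar> + 1)) * x + c"
      using ax x by (intro add_right_mono mult_right_mono) linarith+
    also have "\<dots> \<le> (- (\<bar>c\<bar> + 1)) * 1 + c"
      using x by (intro add_right_mono mult_left_mono_neg) auto
    finally show False using assms[of x] abs_ge_self[of c] by simp
  qed
  moreover have "0 \<le> a * (a * (- b / a)\<^sup>2 + 2 * b * (- b / a) + c)"
    using \<open>a > 0\<close> by (intro mult_nonneg_nonneg assms) simp
  moreover have "a * (a * (- b / a)\<^sup>2 + 2 * b * (- b / a) + c) = a * c - b\<^sup>2"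
    using \<open>a > 0\<close> by (simp add: power2_eq_square field_simps)
  ultimately show ?thesis by simp
qed

text \<open>Induction over the index set, splitting off the rank-one matrix of one row of \<open>Q\<close>
  (a Cholesky step). If the pivot is 0 then the row vanishes, and division by 0 makes the
  rank-one term 0 as well.\<close>
lemma psd_on_trace_nonneg:
  assumes "finite S" "psd_on S Q" "psd_on S Y" "\<And>p q. Q p q = Q q p"
  shows "0 \<le> (\<Sum>p\<in>S. \<Sum>q\<in>S. Q p q * Y p q)"
  using assms
proof (induction S arbitrary: Q rule: finite_induct)
  case (insert r S)
  note sym = insert.prems(3)
  define Q' where "Q' p q = Q p q - Q p r * Q q r / Q r r" for p q
  have form: "0 \<le> Q r r * x\<^sup>2 + 2 * (\<Sum>p\<in>S. u p * Q p r) * x + (\<Sum>p\<in>S. \<Sum>q\<in>S. u p * Q p q * u q)"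
    for u :: "'a \<Rightarrow> real" and x
  proof -
    let ?v = "u(r := x)"
    have "(\<Sum>p\<in>insert r S. \<Sum>q\<in>insert r S. ?v p * Q p q * ?v q)
      = ?v r * Q r r * ?v r + 2 * (\<Sum>p\<in>S. ?v p * Q p r * ?v r) + (\<Sum>p\<in>S. \<Sum>q\<in>S. ?v p * Q p q * ?v q)"
      using insert.hyps by (intro sum_insert_symmetric) (auto simp: sym)
    also have "(\<Sum>p\<in>S. ?v p * Q p r * ?v r) = (\<Sum>p\<in>S. u p * Q p r) * x"
      unfolding sum_distrib_right using insert.hyps by (intro sum.cong) auto
    also have "(\<Sum>p\<in>S. \<Sum>q\<in>S. ?v p * Q p q * ?v q) = (\<Sum>p\<in>S. \<Sum>q\<in>S. u p * Q p q * u q)"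
      using insert.hyps by (intro sum.cong) auto
    finally have "(\<Sum>p\<in>insert r S. \<Sum>q\<in>insert r S. ?v p * Q p q * ?v q)
      = Q r r * x\<^sup>2 + 2 * (\<Sum>p\<in>S. u p * Q p r) * x + (\<Sum>p\<in>S. \<Sum>q\<in>S. u p * Q p q * u q)"
      by (simp add: power2_eq_square algebra_simps)
    moreover have "0 \<le> (\<Sum>p\<in>insert r S. \<Sum>q\<in>insert r S. ?v p * Q p q * ?v q)"
      using insert.prems(1) unfolding psd_on_def by blast
    ultimately show ?thesis by linarith
  qed
  have disc: "(\<Sum>p\<in>S. u p * Q p r)\<^sup>2 \<le> Q r r * (\<Sum>p\<in>S. \<Sum>q\<in>S. u p * Q p q * u q)" for u
    by (rule quadratic_nonneg_imp[OF form])
  have c0: "0 \<le> Q r r" using form[where u = "\<lambda>_. 0" and x = 1] by simp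
  have S0: "0 \<le> (\<Sum>p\<in>S. \<Sum>q\<in>S. u p * Q p q * u q)" for u
    using form[where u = u and x = 0] by simp
  have row: "Q p r = 0" if "Q r r = 0" "p \<in> S" for p
    using disc[of "unitv p"] that insert.hyps by (simp add: sum_unitv_mult)
  have psd': "psd_on S Q'"
    unfolding psd_on_def
  proof
    fix u
    have "(\<Sum>p\<in>S. \<Sum>q\<in>S. u p * Q' p q * u q)
       = (\<Sum>p\<in>S. \<Sum>q\<in>S. u p * Q p q * u q) - (\<Sum>p\<in>S. \<Sum>q\<in>S. (u p * Q p r) * (u q * Q q r) / Q r r)"
      unfolding sum_subtractf[symmetric] Q'_def by (intro sum.cong refl) (simp add: algebra_simps)
    \<comment> \<open>The form of the rank-one part is a perfect square divided by the pivot, which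
      is exactly what the discriminant inequality controls.\<close>
    also have "(\<Sum>p\<in>S. \<Sum>q\<in>S. (u p * Q p r) * (u q * Q q r) / Q r r) = (\<Sum>p\<in>S. u p * Q p r)\<^sup>2 / Q r r"
      by (simp add: power2_eq_square sum_product sum_divide_distrib)
    finally have eq: "(\<Sum>p\<in>S. \<Sum>q\<in>S. u p * Q' p q * u q)
       = (\<Sum>p\<in>S. \<Sum>q\<in>S. u p * Q p q * u q) - (\<Sum>p\<in>S. u p * Q p r)\<^sup>2 / Q r r" .
    have "(\<Sum>p\<in>S. u p * Q p r)\<^sup>2 / Q r r \<le> (\<Sum>p\<in>S. \<Sum>q\<in>S. u p * Q p q * u q)"
      using disc[of u] c0 S0[of u] by (cases "Q r r = 0") (simp_all add: divide_le_eq mult.commute)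
    then show "0 \<le> (\<Sum>p\<in>S. \<Sum>q\<in>S. u p * Q' p q * u q)" unfolding eq by (simp only: diff_ge_0_iff_ge)
  qed
  have Y': "psd_on S Y"
    unfolding psd_on_def
  proof
    fix u :: "'a \<Rightarrow> real"
    let ?v = "\<lambda>p. if p \<in> S then u p else 0"
    have "0 \<le> (\<Sum>p\<in>insert r S. \<Sum>q\<in>insert r S. ?v p * Y p q * ?v q)"
      by (rule insert.prems(2)[unfolded psd_on_def, THEN spec])
    also have "\<dots> = (\<Sum>p\<in>S. \<Sum>q\<in>S. ?v p * Y p q * ?v q)"
      using insert.hyps by simp
    also have "\<dots> = (\<Sum>p\<in>S. \<Sum>q\<in>S. u p * Y p q * u q)" by (intro sum.cong) auto
    finally show "0 \<le> (\<Sum>p\<in>S. \<Sum>q\<in>S. u p * Y p q * u q)" .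
  qed
  have "0 \<le> (\<Sum>p\<in>S. \<Sum>q\<in>S. Q' p q * Y p q)"
  proof (rule insert.IH[OF psd' Y'])
    show "Q' p q = Q' q p" for p q
      unfolding Q'_def sym[of q p] by (simp only: mult.commute)
  qed
  also have "\<dots> = (\<Sum>p\<in>insert r S. \<Sum>q\<in>insert r S. Q' p q * Y p q)"
  proof -
    have z: "Q' r r = 0" "Q' p r = 0 \<and> Q' r p = 0" if "p \<in> S" for p
      using row[OF _ that] sym[of r p] by (cases "Q r r = 0"; simp add: Q'_def)+
    have zr: "Q' r r = 0" by (cases "Q r r = 0"; simp add: Q'_def)
    show ?thesis using insert.hyps z zr by simp
  qed
  finally have 1: "0 \<le> (\<Sum>p\<in>insert r S. \<Sum>q\<in>insert r S. Q' p q * Y p q)" .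
  have 2: "0 \<le> (\<Sum>p\<in>insert r S. \<Sum>q\<in>insert r S. Q p r * Y p q * Q q r)"
    using insert.prems(2)[unfolded psd_on_def, THEN spec, of "\<lambda>p. Q p r"] .
  have "(\<Sum>p\<in>insert r S. \<Sum>q\<in>insert r S. Q p q * Y p q)
    = (\<Sum>p\<in>insert r S. \<Sum>q\<in>insert r S. Q' p q * Y p q)
      + (\<Sum>p\<in>insert r S. \<Sum>q\<in>insert r S. Q p r * Y p q * Q q r) / Q r r"
    unfolding sum_divide_distrib sum.distrib[symmetric]
    by (intro sum.cong refl) (simp add: Q'_def algebra_simps)
  then show ?case using 1 2 c0 by (simp only: add_nonneg_nonneg divide_nonneg_nonneg)
qed simp

section \<open>Degree and evaluation of polynomials\<close>

lemma mon_degree_superset: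
  assumes "finite K" "Poly_Mapping.keys m \<subseteq> K"
  shows "mon_degree m = (\<Sum>i\<in>K. Poly_Mapping.lookup m i)"
  unfolding mon_degree_def using assms by (intro sum.mono_neutral_left) (auto simp: in_keys_iff)

lemma mon_degree_add: "mon_degree (m + m') = mon_degree m + mon_degree m'"
proof -
  let ?K = "Poly_Mapping.keys m \<union> Poly_Mapping.keys m'"
  show ?thesis
    using Poly_Mapping.keys_add[of m m']
    by (simp add: mon_degree_superset[of ?K] lookup_add sum.distrib)
qed

lemma polys_mono: "d \<le> e \<Longrightarrow> p \<in> polys n d \<Longrightarrow> p \<in> polys n e"
  unfolding polys_def by fastforce

lemma polys_add: "p \<in> polys n d \<Longrightarrow> q \<in> polys n d \<Longrightarrow> p + q \<in> polys n d"
  unfolding polys_def using Poly_Mapping.keys_add[of p q] by blast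

lemma polys_zero: "0 \<in> polys n d"
  by (simp add: polys_def)

lemma polys_sum: "(\<And>x. x \<in> A \<Longrightarrow> f x \<in> polys n d) \<Longrightarrow> sum f A \<in> polys n d"
  by (induction A rule: infinite_finite_induct) (auto intro: polys_add polys_zero)

lemma polys_mult:
  assumes "p \<in> polys n d" "q \<in> polys n e"
  shows "p * q \<in> polys n (d + e)"
  unfolding polys_def
proof (intro CollectI ballI)
  fix m assume "m \<in> Poly_Mapping.keys (p * q)"
  then obtain a b where ab: "m = a + b" "a \<in> Poly_Mapping.keys p" "b \<in> Poly_Mapping.keys q"
    using keys_mult[of p q] by blast
  show "Poly_Mapping.keys m \<subseteq> {..<n} \<and> mon_degree m \<le> d + e"
    using assms ab Poly_Mapping.keys_add[of a b] unfolding polys_def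
    by (fastforce simp: mon_degree_add intro: add_mono)
qed

lemma polys_Const: "Const c \<in> polys n d"
  by (simp add: polys_def Const_def mon_degree_def)

lemma polys_Const_mult: "p \<in> polys n d \<Longrightarrow> Const c * p \<in> polys n d"
  using polys_mult[OF polys_Const[of c n 0], of p d] by simp

lemma polys_Var: "i < n \<Longrightarrow> Var i \<in> polys n 1"
  by (simp add: polys_def Var_def mon_degree_def)

lemma Const_1: "Const 1 = 1"
  by (simp add: Const_def)

lemma Const_mult: "Const a * Const b = Const (a * b)"
  by (simp add: Const_def mult_single)

lemma Const_0: "Const 0 = 0"
  by (simp add: Const_def)

lemma Const_uminus: "Const (- a) = - Const a"
  by (simp add: Const_def single_uminus)

definition mon_eval :: "(nat \<Rightarrow>\<^sub>0 nat) \<Rightarrow> (nat \<Rightarrow> real) \<Rightarrow> real" where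
  "mon_eval m x = (\<Prod>i\<in>Poly_Mapping.keys m. x i ^ Poly_Mapping.lookup m i)"

lemma mon_eval_superset:
  assumes "finite K" "Poly_Mapping.keys m \<subseteq> K"
  shows "mon_eval m x = (\<Prod>i\<in>K. x i ^ Poly_Mapping.lookup m i)"
  unfolding mon_eval_def using assms by (intro prod.mono_neutral_left) (auto simp: in_keys_iff)

lemma mon_eval_add: "mon_eval (m + m') x = mon_eval m x * mon_eval m' x"
proof -
  let ?K = "Poly_Mapping.keys m \<union> Poly_Mapping.keys m'"
  show ?thesis
    using Poly_Mapping.keys_add[of m m']
    by (simp add: mon_eval_superset[of ?K] lookup_add power_add prod.distrib)
qed

lemma eval_poly_superset:
  assumes "finite K" "Poly_Mapping.keys p \<subseteq> K"
  shows "eval_poly p x = (\<Sum>m\<in>K. Poly_Mapping.lookup p m * mon_eval m x)"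
  unfolding eval_poly_def mon_eval_def[symmetric]
  using assms by (intro sum.mono_neutral_left) (auto simp: in_keys_iff)

lemma eval_poly_add: "eval_poly (p + q) x = eval_poly p x + eval_poly q x"
proof -
  let ?K = "Poly_Mapping.keys p \<union> Poly_Mapping.keys q"
  show ?thesis
    using Poly_Mapping.keys_add[of p q]
    by (simp add: eval_poly_superset[of ?K] lookup_add sum.distrib algebra_simps)
qed

lemma eval_poly_zero: "eval_poly 0 x = 0"
  by (simp add: eval_poly_def)

lemma eval_poly_sum: "eval_poly (sum f A) x = (\<Sum>a\<in>A. eval_poly (f a) x)"
  by (induction A rule: infinite_finite_induct) (auto simp: eval_poly_add eval_poly_zero)

lemma eval_poly_single: "eval_poly (Poly_Mapping.single m c) x = c * mon_eval m x"
  using eval_poly_superset[of "{m}" "Poly_Mapping.single m c" x] by simp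

lemma eval_cubic_poly:
  "eval_poly (cubic_poly n T) x = (\<Sum>i<n. x i * (\<Sum>j<n. \<Sum>k<n. x j * T i j k * x k))"
proof -
  have v: "mon_eval (Poly_Mapping.single i 1) x = x i" for i
    by (simp add: mon_eval_def)
  have ev: "eval_poly (Const c * Var i * Var j * Var k) x = c * x i * x j * x k" for c i j k
    unfolding Const_def Var_def mult_single eval_poly_single mon_eval_add v by (simp add: mon_eval_def)
  show ?thesis
    unfolding cubic_poly_def eval_poly_sum ev sum_distrib_left
    by (intro sum.cong refl) (simp only: mult_ac)
qed

section \<open>Moments and Cauchy-Schwarz for degree-4 pseudo-expectations\<close>

context
  fixes n :: nat and E :: "mpoly \<Rightarrow> real"
  assumes pe: "pseudo_expectation n 4 E"
begin

lemma pe_add: "p \<in> polys n 4 \<Longrightarrow> q \<in> polys n 4 \<Longrightarrow> E (p + q) = E p + E q"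
  using pe[unfolded pseudo_expectation_def, THEN conjunct1, rule_format, of p q 1 1] by (simp add: Const_1)

lemma pe_Const_mult: "p \<in> polys n 4 \<Longrightarrow> E (Const a * p) = a * E p"
  using pe[unfolded pseudo_expectation_def, THEN conjunct1, rule_format, of p p a 0] by (simp add: Const_0)

lemma pe_sum: "(\<And>x. x \<in> A \<Longrightarrow> f x \<in> polys n 4) \<Longrightarrow> E (sum f A) = (\<Sum>x\<in>A. E (f x))"
proof (induction A rule: infinite_finite_induct)
  case (insert x A)
  then show ?case by (simp add: pe_add polys_sum)
qed (use pe_Const_mult[OF polys_zero, of 0] in \<open>simp_all add: Const_0\<close>)

lemma pe_sum2:
  assumes "\<And>x y. x \<in> A \<Longrightarrow> y \<in> B \<Longrightarrow> f x y \<in> polys n 4"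
  shows "E (\<Sum>x\<in>A. \<Sum>y\<in>B. f x y) = (\<Sum>x\<in>A. \<Sum>y\<in>B. E (f x y))"
  by (subst pe_sum) (auto intro!: polys_sum sum.cong pe_sum assms)

lemma pe_one: "E 1 = 1"
  using pe by (simp add: pseudo_expectation_def)

lemma pe_square_nonneg: "p \<in> polys n 2 \<Longrightarrow> 0 \<le> E (p * p)"
  using pe by (simp add: pseudo_expectation_def)

lemma pe_mult_in: "p \<in> polys n 2 \<Longrightarrow> q \<in> polys n 2 \<Longrightarrow> p * q \<in> polys n 4"
  using polys_mult[of p n 2 q 2] by simp

text \<open>This is the pseudo-expectation of (s p - q)^2, arranged as a quadratic in s so that its
  discriminant gives Cauchy-Schwarz.\<close>

lemma pe_square_lincomb:
  assumes "p \<in> polys n 2" "q \<in> polys n 2"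
  shows "0 \<le> s\<^sup>2 * E (p * p) + 2 * (- E (p * q)) * s + E (q * q)"
proof -
  let ?r = "Const s * p + Const (- 1) * q"
  have "?r * ?r = Const (s\<^sup>2) * (p * p) + (Const (- 2 * s) * (p * q) + q * q)"
    by (simp add: algebra_simps Const_mult[symmetric] Const_uminus Const_1 power2_eq_square)
       (simp add: Const_def algebra_simps flip: single_add mult_2)
  then have "E (?r * ?r) = s\<^sup>2 * E (p * p) + ((- 2 * s) * E (p * q) + E (q * q))"
    using assms pe_mult_in by (simp add: pe_add pe_Const_mult polys_Const_mult polys_add)
  moreover have "?r \<in> polys n 2" using assms by (intro polys_add polys_Const_mult)
  ultimately show ?thesis using pe_square_nonneg[of ?r] by (simp add: algebra_simps)
qed

lemma polys_Var2: "a < n \<Longrightarrow> b < n \<Longrightarrow> Var a * Var b \<in> polys n 2"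
  using polys_mult[OF polys_Var polys_Var] by (simp add: numeral_2_eq_2)

text \<open>Commutativity of the variables makes this invariant under all permutations of the four
  indices, which is more than symmetry in p and q. For this reason the identity and
  \<open>cup_matrix\<close> pair with it to the same value, the pseudo-expectation of the fourth
  power of the norm.\<close>

definition moment4 :: "nat \<times> nat \<Rightarrow> nat \<times> nat \<Rightarrow> real" where
  "moment4 p q = E (Var (fst p) * Var (snd p) * (Var (fst q) * Var (snd q)))"

lemma psd_moment4: "psd_on (pairs n) moment4"
  unfolding psd_on_def
proof
  fix u :: "nat \<times> nat \<Rightarrow> real"
  let ?P = "pairs n"
  let ?x = "\<lambda>p. Var (fst p) * Var (snd p)"
  let ?r = "\<Sum>p\<in>?P. Const (u p) * ?x p"
  have x: "?x p \<in> polys n 2" if "p \<in> ?P" for p using that by (auto intro: polys_Var2)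
  have r: "?r \<in> polys n 2"
    by (intro polys_sum polys_Const_mult x)
  have "?r * ?r = (\<Sum>p\<in>?P. \<Sum>q\<in>?P. Const (u p * u q) * (?x p * ?x q))"
    by (simp add: sum_product Const_mult[symmetric] mult_ac)
  also have "E \<dots> = (\<Sum>p\<in>?P. \<Sum>q\<in>?P. u p * u q * moment4 p q)"
  proof (subst pe_sum2, intro polys_Const_mult pe_mult_in x, assumption, assumption, intro sum.cong refl)
    fix p q assume "p \<in> ?P" "q \<in> ?P"
    from pe_Const_mult[OF pe_mult_in[OF x[OF this(1)] x[OF this(2)]]]
    show "E (Const (u p * u q) * (?x p * ?x q)) = u p * u q * moment4 p q"
      by (simp add: moment4_def)
  qed
  finally show "0 \<le> (\<Sum>p\<in>?P. \<Sum>q\<in>?P. u p * moment4 p q * u q)"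
    using pe_square_nonneg[OF r] by (simp add: mult_ac)
qed

lemma moment4_sym: "moment4 p q = moment4 q p"
  by (simp add: moment4_def mult_ac)

lemma pe_norm4: "E (norm4_poly n) = (\<Sum>a<n. \<Sum>c<n. moment4 (a, a) (c, c))"
proof -
  have "norm4_poly n = (\<Sum>a<n. \<Sum>c<n. Var a * Var a * (Var c * Var c))"
    by (simp add: norm4_poly_def power2_eq_square sum_product)
  then show ?thesis
    by (simp only:) (subst pe_sum2, auto simp: pe_mult_in polys_Var2 moment4_def)
qed

text \<open>Write g_i for the quadratic form of A_i. Cauchy-Schwarz bounds the square of the left
  side by \<open>m2 * G\<close>, with G the sum of the pseudo-expectations of g_i^2. Here m2 is at
  most the square root of m4, and G is at most l^2 m4 by pairing the positive semidefinite matrix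
  with the moments; the product l^2 m4^(3/2) is the origin of the exponent 3/4.\<close>

lemma pe_cubic_le:
  fixes A :: "nat \<Rightarrow> nat \<Rightarrow> nat \<Rightarrow> real" and l :: real
  assumes "0 \<le> l"
    and psd: "psd_on (pairs n)
       (\<lambda>p q. (if p = q then l\<^sup>2 - n else 0) + n * cup_matrix p q - (\<Sum>i<n. kron (A i) (A i) p q))"
  shows "E (cubic_poly n A) \<le> l * E (norm4_poly n) powr (3/4)"
proof -
  let ?P = "pairs n"
  define m4 where "m4 = E (norm4_poly n)"
  define nn where "nn = (\<Sum>i<n. Var i * Var i)"
  define m2 where "m2 = E nn"
  define g where "g i = (\<Sum>j<n. \<Sum>k<n. Const (A i j k) * (Var j * Var k))" for i
  have nn: "nn \<in> polys n 2" unfolding nn_def by (intro polys_sum polys_Var2) auto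
  have g: "g i \<in> polys n 2" for i
    unfolding g_def by (intro polys_sum polys_Const_mult polys_Var2) auto
  have V: "Var i \<in> polys n 2" if "i < n" for i using polys_mono[OF _ polys_Var[OF that], of 2] by simp
  have one: "1 \<in> polys n 2" using polys_Const[of 1] by (simp add: Const_1)
  have m2: "m2 = (\<Sum>i<n. E (Var i * Var i))"
    unfolding m2_def nn_def by (intro pe_sum) (auto intro: pe_mult_in V)
  have m20: "0 \<le> m2" unfolding m2 by (intro sum_nonneg pe_square_nonneg V) auto
  have m4: "m4 = E (nn * nn)" by (simp add: m4_def nn_def norm4_poly_def power2_eq_square)
  have m40: "0 \<le> m4" unfolding m4 by (rule pe_square_nonneg[OF nn])
  have "m2\<^sup>2 \<le> 1 * m4"
  proof -
    have "(- m2)\<^sup>2 \<le> 1 * m4"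
      by (rule quadratic_nonneg_imp)
         (use pe_square_lincomb[OF one nn] in \<open>simp add: pe_one m4 m2_def mult_ac\<close>)
    then show ?thesis by simp
  qed
  then have m2_le: "m2 \<le> sqrt m4" by (simp add: real_le_rsqrt)
  define G where "G = (\<Sum>i<n. E (g i * g i))"
  have f: "E (cubic_poly n A) = (\<Sum>i<n. E (Var i * g i))"
  proof -
    have "cubic_poly n A = (\<Sum>i<n. Var i * g i)"
      by (simp add: cubic_poly_def g_def sum_distrib_left mult_ac)
    then show ?thesis by (simp only:) (intro pe_sum pe_mult_in V g, simp)
  qed
  \<comment> \<open>A single discriminant for the whole sum over i: the quadratic in s is the sum of
    the pseudo-expectations of (s x_i - g_i)^2.\<close>
  have "(- E (cubic_poly n A))\<^sup>2 \<le> m2 * G"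
  proof (rule quadratic_nonneg_imp)
    fix s
    have "0 \<le> (\<Sum>i<n. s\<^sup>2 * E (Var i * Var i) + 2 * (- E (Var i * g i)) * s + E (g i * g i))"
      using pe_square_lincomb V g by (intro sum_nonneg) auto
    also have "\<dots> = m2 * s\<^sup>2 + 2 * (- E (cubic_poly n A)) * s + G"
      by (simp add: m2 f G_def sum.distrib sum_distrib_left sum_distrib_right sum_negf sum_subtractf mult_ac)
    finally show "0 \<le> m2 * s\<^sup>2 + 2 * (- E (cubic_poly n A)) * s + G" .
  qed
  then have fsq: "(E (cubic_poly n A))\<^sup>2 \<le> m2 * G" by simp
  define Q where "Q p q = (if p = q then l\<^sup>2 - n else 0) + n * cup_matrix p q - (\<Sum>i<n. kron (A i) (A i) p q)"
    for p q
  have psd: "psd_on ?P Q" using psd by (simp only: Q_def[abs_def])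
  \<comment> \<open>Q need not be symmetric, as the A_i are arbitrary. Averaging with the transpose
    changes neither its quadratic form nor its pairing with the symmetric
    \<open>moment4\<close>.\<close>
  have "0 \<le> (\<Sum>p\<in>?P. \<Sum>q\<in>?P. (Q p q + Q q p) / 2 * moment4 p q)"
  proof (rule psd_on_trace_nonneg[OF _ _ psd_moment4])
    show "psd_on ?P (\<lambda>p q. (Q p q + Q q p) / 2)"
      unfolding psd_on_def
    proof
      fix u :: "nat \<times> nat \<Rightarrow> real"
      have "(\<Sum>p\<in>?P. \<Sum>q\<in>?P. u p * ((Q p q + Q q p) / 2) * u q)
        = ((\<Sum>p\<in>?P. \<Sum>q\<in>?P. u p * Q p q * u q) + (\<Sum>p\<in>?P. \<Sum>q\<in>?P. u p * Q q p * u q)) / 2"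
        unfolding sum.distrib[symmetric] sum_divide_distrib
        by (intro sum.cong refl) (simp add: algebra_simps add_divide_distrib)
      also have "(\<Sum>p\<in>?P. \<Sum>q\<in>?P. u p * Q q p * u q) = (\<Sum>p\<in>?P. \<Sum>q\<in>?P. u p * Q p q * u q)"
        by (subst sum.swap) (intro sum.cong refl, simp only: mult_ac)
      finally show "0 \<le> (\<Sum>p\<in>?P. \<Sum>q\<in>?P. u p * ((Q p q + Q q p) / 2) * u q)"
        using psd unfolding psd_on_def by (simp only:) simp
    qed
  qed (simp_all add: add.commute)
  also have "\<dots> = (\<Sum>p\<in>?P. \<Sum>q\<in>?P. Q p q * moment4 p q)"
  proof -
    have "(\<Sum>p\<in>?P. \<Sum>q\<in>?P. (Q p q + Q q p) / 2 * moment4 p q)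
      = ((\<Sum>p\<in>?P. \<Sum>q\<in>?P. Q p q * moment4 p q) + (\<Sum>p\<in>?P. \<Sum>q\<in>?P. Q q p * moment4 p q)) / 2"
      unfolding sum.distrib[symmetric] sum_divide_distrib
      by (intro sum.cong refl) (simp add: algebra_simps add_divide_distrib)
    also have "(\<Sum>p\<in>?P. \<Sum>q\<in>?P. Q q p * moment4 p q) = (\<Sum>p\<in>?P. \<Sum>q\<in>?P. Q p q * moment4 p q)"
      by (subst sum.swap) (intro sum.cong refl, simp only: moment4_sym)
    finally show ?thesis by simp
  qed
  also have "\<dots> = (\<Sum>p\<in>?P. \<Sum>q\<in>?P. (if p = q then l\<^sup>2 - n else 0) * moment4 p q)
      + (\<Sum>p\<in>?P. \<Sum>q\<in>?P. n * cup_matrix p q * moment4 p q)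
      - (\<Sum>p\<in>?P. \<Sum>q\<in>?P. (\<Sum>i<n. kron (A i) (A i) p q) * moment4 p q)"
    unfolding sum.distrib[symmetric] sum_subtractf[symmetric] Q_def
    by (intro sum.cong refl) (simp only: algebra_simps)
  also have "(\<Sum>p\<in>?P. \<Sum>q\<in>?P. (if p = q then l\<^sup>2 - n else 0) * moment4 p q) = (l\<^sup>2 - n) * m4"
  proof -
    have "(\<Sum>p\<in>?P. \<Sum>q\<in>?P. (if p = q then l\<^sup>2 - n else 0) * moment4 p q) = (\<Sum>p\<in>?P. (l\<^sup>2 - n) * moment4 p p)"
      by (intro sum.cong refl) (simp add: if_distrib[of "\<lambda>x. x * _"] cong: if_cong)
    also have "\<dots> = (l\<^sup>2 - n) * (\<Sum>a<n. \<Sum>b<n. moment4 (a, a) (b, b))"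
      by (simp add: sum_Times sum_distrib_left moment4_def mult_ac)
    finally show ?thesis by (simp add: m4_def pe_norm4)
  qed
  also have "(\<Sum>p\<in>?P. \<Sum>q\<in>?P. n * cup_matrix p q * moment4 p q) = n * m4"
  proof -
    have "(\<Sum>p\<in>?P. \<Sum>q\<in>?P. n * cup_matrix p q * moment4 p q)
      = (\<Sum>p\<in>?P. if fst p = snd p then \<Sum>q\<in>?P. if fst q = snd q then n * moment4 p q else 0 else 0)"
      by (intro sum.cong refl) (auto simp: cup_matrix_def intro!: sum.cong)
    also have "\<dots> = (\<Sum>a<n. \<Sum>c<n. n * moment4 (a, a) (c, c))"
      by (simp add: sum_diagonal)
    finally show ?thesis by (simp add: m4_def pe_norm4 sum_distrib_left)
  qed
  also have "(\<Sum>p\<in>?P. \<Sum>q\<in>?P. (\<Sum>i<n. kron (A i) (A i) p q) * moment4 p q) = G"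
  proof -
    have gi: "E (g i * g i) = (\<Sum>j<n. \<Sum>k<n. \<Sum>j'<n. \<Sum>k'<n. A i j k * A i j' k' * moment4 (j, k) (j', k'))" for i
    proof -
      have "g i * g i = (\<Sum>j<n. \<Sum>k<n. \<Sum>j'<n. \<Sum>k'<n.
          Const (A i j k * A i j' k') * ((Var j * Var k) * (Var j' * Var k')))"
        unfolding g_def sum_distrib_right sum_distrib_left
        by (simp add: Const_mult[symmetric] mult_ac)
      then show ?thesis
        by (simp only:, subst pe_sum2, (intro polys_sum polys_Const_mult pe_mult_in polys_Var2; simp),
            intro sum.cong refl, subst pe_sum2)
          (auto simp: pe_Const_mult polys_Const_mult pe_mult_in polys_Var2 moment4_def)
    qed
    have "(\<Sum>p\<in>?P. \<Sum>q\<in>?P. (\<Sum>i<n. kron (A i) (A i) p q) * moment4 p q)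
      = (\<Sum>i<n. \<Sum>p\<in>?P. \<Sum>q\<in>?P. kron (A i) (A i) p q * moment4 p q)"
    proof -
      have "(\<Sum>p\<in>?P. \<Sum>q\<in>?P. \<Sum>i<n. kron (A i) (A i) p q * moment4 p q)
          = (\<Sum>p\<in>?P. \<Sum>i<n. \<Sum>q\<in>?P. kron (A i) (A i) p q * moment4 p q)"
        by (rule sum.cong[OF refl], rule sum.swap)
      also have "\<dots> = (\<Sum>i<n. \<Sum>p\<in>?P. \<Sum>q\<in>?P. kron (A i) (A i) p q * moment4 p q)"
        by (rule sum.swap)
      finally show ?thesis by (simp only: sum_distrib_right)
    qed
    also have "\<dots> = G"
      unfolding G_def
    proof (rule sum.cong[OF refl])
      fix i
      have "(\<Sum>p\<in>?P. \<Sum>q\<in>?P. kron (A i) (A i) p q * moment4 p q)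
        = (\<Sum>a<n. \<Sum>b<n. \<Sum>c<n. \<Sum>d<n. A i a c * A i b d * moment4 (a, c) (b, d))"
        by (simp add: sum_Times kron_def moment4_def mult_ac)
      \<comment> \<open>The Kronecker product groups rows (a, b) against columns (c, d), the square
        of g_i groups the indices of each A_i; permutation invariance of the moments identifies the
        two.\<close>
      also have "\<dots> = (\<Sum>a<n. \<Sum>c<n. \<Sum>b<n. \<Sum>d<n. A i a c * A i b d * moment4 (a, c) (b, d))"
        by (rule sum.cong[OF refl], rule sum.swap)
      finally show "(\<Sum>p\<in>?P. \<Sum>q\<in>?P. kron (A i) (A i) p q * moment4 p q) = E (g i * g i)"
        unfolding gi .
    qed
    finally show ?thesis .
  qed
  finally have "G \<le> l\<^sup>2 * m4" by (simp add: algebra_simps)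
  have "(E (cubic_poly n A))\<^sup>2 \<le> sqrt m4 * (l\<^sup>2 * m4)"
  proof -
    have G0: "0 \<le> G" unfolding G_def by (intro sum_nonneg pe_square_nonneg g)
    note fsq
    also have "m2 * G \<le> sqrt m4 * (l\<^sup>2 * m4)"
      using m2_le \<open>G \<le> l\<^sup>2 * m4\<close> G0 m40 by (intro mult_mono) auto
    finally show ?thesis .
  qed
  also have "sqrt m4 * (l\<^sup>2 * m4) = (l * m4 powr (3/4))\<^sup>2"
  proof (cases "m4 = 0")
    case False
    then have "m4 > 0" using m40 by simp
    then have "m4 powr (1/2) * m4 powr 1 = m4 powr (3/4) * m4 powr (3/4)"
      by (simp only: powr_add[symmetric]) simp
    then show ?thesis using \<open>m4 > 0\<close> by (simp add: powr_half_sqrt power2_eq_square mult_ac)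
  qed simp
  finally have "(E (cubic_poly n A))\<^sup>2 \<le> (l * m4 powr (3/4))\<^sup>2" .
  then have "E (cubic_poly n A) \<le> l * m4 powr (3/4)"
    by (rule power2_le_imp_le) (use assms(1) in simp)
  then show ?thesis by (simp add: m4_def)
qed

end

section \<open>The bound with high probability\<close>

text \<open>An antisymmetric part contributes nothing to a quadratic form, so a bound for the
  symmetrised sum serves the original one.\<close>

lemma sum_sym_kron_form:
  "(\<Sum>p\<in>S. u p * matvec S (\<lambda>p q. \<Sum>i<n. sym_kron T i p q) u p) = (\<Sum>p\<in>S. \<Sum>q\<in>S. u p * (\<Sum>i<n. centered_kron T i p q) * u q)"
proof -
  let ?F = "\<lambda>M. \<Sum>p\<in>S. \<Sum>q\<in>S. u p * M p q * u q :: real"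
  define w where "w p q = (\<Sum>i<n. centered_kron T i p q)" for p q
  have avg: "(\<Sum>i<n. sym_kron T i p q) = (w p q + w q p) / 2" for p q
    by (simp add: sym_kron_def w_def sum.distrib[symmetric] sum_divide_distrib[symmetric])
  have "?F (\<lambda>p q. w q p) = ?F w"
    by (subst sum.swap) (intro sum.cong refl, simp only: mult_ac)
  moreover have "?F (\<lambda>p q. (w p q + w q p) / 2) = (?F w + ?F (\<lambda>p q. w q p)) / 2"
    unfolding sum.distrib[symmetric] sum_divide_distrib
    by (intro sum.cong refl) (simp add: algebra_simps add_divide_distrib)
  ultimately have "?F (\<lambda>p q. (w p q + w q p) / 2) = ?F w" by simp
  then show ?thesis by (simp add: matvec_def avg sum_distrib_left mult.assoc w_def[symmetric])
qed

text \<open>The matrix required to be positive semidefinite, for l^2 M = (l^2 - n) I + n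
  \<open>cup_matrix\<close>. The coefficient n of the cup matrix cancels the mean, and the
  coefficient of I is then forced: the weights must sum to l^2 for M to represent the fourth power
  of the norm.\<close>

definition residual :: "nat \<Rightarrow> real \<Rightarrow> (nat \<times> nat \<times> nat \<Rightarrow> real) \<Rightarrow> nat \<times> nat \<Rightarrow> nat \<times> nat \<Rightarrow> real" where
  "residual n l T p q = (if p = q then l\<^sup>2 - n else 0) + n * cup_matrix p q
     - (\<Sum>i<n. kron (\<lambda>j k. T (i, j, k)) (\<lambda>j k. T (i, j, k)) p q)"

text \<open>After the mean has cancelled, the residual is (l^2 - n) I minus the centred sum, so a
  bound t on the form of that sum with t \<le> l^2 - n is enough.\<close>

lemma psd_residual:
  fixes n :: nat
  defines "P \<equiv> pairs n"
  assumes form: "\<And>u. (\<Sum>p\<in>P. u p * matvec P (\<lambda>p q. \<Sum>i<n. sym_kron T i p q) u p) \<le> t * (L2_set u P)\<^sup>2"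
    and l: "t + n \<le> l\<^sup>2"
  shows "psd_on P (residual n l T)"
  unfolding psd_on_def
proof
  fix u
  have fin: "finite P" by (simp add: P_def)
  have res: "residual n l T p q = (if p = q then l\<^sup>2 - n else 0) - (\<Sum>i<n. centered_kron T i p q)" for p q
    by (simp add: residual_def kron_def centered_kron_def split_def sum_subtractf)
  have "(\<Sum>p\<in>P. \<Sum>q\<in>P. u p * residual n l T p q * u q)
     = (\<Sum>p\<in>P. \<Sum>q\<in>P. (if p = q then (l\<^sup>2 - n) * (u p)\<^sup>2 else 0)) - (\<Sum>p\<in>P. \<Sum>q\<in>P. u p * (\<Sum>i<n. centered_kron T i p q) * u q)"
    unfolding sum_subtractf[symmetric] res
    by (intro sum.cong refl) (auto simp: power2_eq_square algebra_simps)
  also have "(\<Sum>p\<in>P. \<Sum>q\<in>P. (if p = q then (l\<^sup>2 - n) * (u p)\<^sup>2 else 0)) = (l\<^sup>2 - n) * (L2_set u P)\<^sup>2"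
    using fin by (simp add: L2_set_squared sum_distrib_left)
  also have "(\<Sum>p\<in>P. \<Sum>q\<in>P. u p * (\<Sum>i<n. centered_kron T i p q) * u q) = (\<Sum>p\<in>P. u p * matvec P (\<lambda>p q. \<Sum>i<n. sym_kron T i p q) u p)"
    by (rule sum_sym_kron_form[symmetric])
  finally have "(\<Sum>p\<in>P. \<Sum>q\<in>P. u p * residual n l T p q * u q)
     = (l\<^sup>2 - n) * (L2_set u P)\<^sup>2 - (\<Sum>p\<in>P. u p * matvec P (\<lambda>p q. \<Sum>i<n. sym_kron T i p q) u p)" .
  moreover have "t * (L2_set u P)\<^sup>2 \<le> (l\<^sup>2 - n) * (L2_set u P)\<^sup>2"
    using l by (intro mult_right_mono) auto
  ultimately show "0 \<le> (\<Sum>p\<in>P. \<Sum>q\<in>P. u p * residual n l T p q * u q)"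
    using form[of u] by linarith
qed

lemma lambda_bounded_of_psd:
  assumes psd: "psd_on (pairs n) (residual n l T)" and l: "l > 0"
  shows "lambda_bounded n (cubic_poly n (\<lambda>i j k. T (i, j, k))) l"
proof -
  define M where "M p q = ((if p = q then l\<^sup>2 - n else 0) + n * cup_matrix p q) / l\<^sup>2"
    for p q :: "nat \<times> nat"
  have lM: "l\<^sup>2 * M p q = (if p = q then l\<^sup>2 - n else 0) + n * cup_matrix p q" for p q
    using l by (simp add: M_def)
  have "matrep_norm4 n M"
    unfolding matrep_norm4_def
  proof
    fix x :: "nat \<Rightarrow> real"
    let ?F = "\<lambda>N. \<Sum>a<n. \<Sum>b<n. \<Sum>c<n. \<Sum>d<n. x a * x b * N (a, b) (c, d) * x c * x d"
    let ?P = "pairs n"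
    define u where "u p = x (fst p) * x (snd p)" for p
    have F: "?F N = (\<Sum>p\<in>?P. \<Sum>q\<in>?P. u p * N p q * u q)" for N
      by (simp add: sum_Times u_def mult.assoc)
    have F1: "?F (\<lambda>p q. if p = q then 1 else 0) = (\<Sum>i<n. x i ^ 2) ^ 2"
    proof -
      have "?F (\<lambda>p q. if p = q then 1 else 0) = (\<Sum>p\<in>?P. \<Sum>q\<in>?P. if p = q then u p * u p else 0)"
        by (subst F[of "\<lambda>p q. if p = q then 1 else 0"]) (intro sum.cong refl, simp)
      also have "\<dots> = (\<Sum>p\<in>?P. u p * u p)" by simp
      also have "\<dots> = (\<Sum>i<n. x i ^ 2) ^ 2"
        by (simp add: sum_Times u_def power2_eq_square sum_product mult_ac)
      finally show ?thesis .
    qed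
    have F2: "?F cup_matrix = (\<Sum>i<n. x i ^ 2) ^ 2"
      unfolding F by (simp add: cup_matrix_form u_def power2_eq_square)
    have "l\<^sup>2 * ?F M = ?F (\<lambda>p q. l\<^sup>2 * M p q)"
      unfolding sum_distrib_left by (intro sum.cong refl) (simp only: mult_ac)
    also have "\<dots> = (l\<^sup>2 - n) * ?F (\<lambda>p q. if p = q then 1 else 0) + n * ?F cup_matrix"
      unfolding lM sum_distrib_left sum.distrib[symmetric]
      by (intro sum.cong refl) (simp add: algebra_simps)
    also have "\<dots> = l\<^sup>2 * (\<Sum>i<n. x i ^ 2) ^ 2"
      unfolding F1 F2 by (simp add: algebra_simps)
    finally show "?F M = (\<Sum>i<n. x i ^ 2) ^ 2" using l by simp
  qed
  moreover have "\<forall>u. 0 \<le> (\<Sum>p\<in>pairs n. \<Sum>q\<in>pairs n. u p * (l ^ 2 * M p q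
      - (\<Sum>i<n. kron (\<lambda>j k. T (i, j, k)) (\<lambda>j k. T (i, j, k)) p q)) * u q)"
    using psd unfolding psd_on_def lM residual_def .
  ultimately show ?thesis
    unfolding lambda_bounded_def using eval_cubic_poly[of n "\<lambda>i j k. T (i, j, k)"]
    by (intro exI[of _ "\<lambda>i j k. T (i, j, k)"] exI[of _ M]) auto
qed

lemma power_of_two_between:
  assumes "x > 1"
  obtains j where "j > 0" "x \<le> 2 ^ j" "2 ^ j \<le> 2 * (x :: real)"
proof -
  define j where "j = (LEAST j. x \<le> 2 ^ j)"
  have "\<exists>j. x \<le> 2 ^ j" using real_arch_pow[of 2 x] by (auto intro: less_imp_le)
  then have j: "x \<le> 2 ^ j" unfolding j_def by (rule LeastI_ex)
  have "j > 0" using j assms by (cases j) auto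
  moreover have "\<not> x \<le> 2 ^ (j - 1)"
    using \<open>j > 0\<close> unfolding j_def by (intro not_less_Least) simp
  then have "2 ^ j \<le> 2 * x" using \<open>j > 0\<close> by (cases j) auto
  ultimately show ?thesis using j that by blast
qed

text \<open>From N \<le> 26 ln n \<le> 36 ln n one gets sqrt N \<le> 6 sqrt (ln n), and 96 = 2 * 8 *
  6 collects the numerical factors of \<open>t\<close>. The summand 1 absorbs n in
  \<open>t + n \<le> l\<^sup>2\<close>, and the root passes from l^2 to l.\<close>

definition bound_const :: real where "bound_const = sqrt (96 * (exp 1)\<^sup>2 * net_const\<^sup>2 + 1)"

text \<open>N is a power of two between 13 ln n and 26 ln n: then exp (-N) \<le> n^(-13), which
  against the factor n^3 of the tail leaves n^(-10). The threshold is 104^2: with ln n = 2 ln (sqrt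
  n) \<le> 2 sqrt n it gives 52 ln n \<le> n, hence 2 N \<le> n.\<close>

lemma gauss_tensor_event:
  fixes n :: nat
  assumes n: "n \<ge> 10816"
  defines "l \<equiv> bound_const * real n powr (3/4) * ln (real n) powr (1/4)"
  shows "\<exists>S \<in> sets (gauss_tensor n). measure (gauss_tensor n) S \<ge> 1 - 4 / real n ^ 10 \<and>
    (\<forall>T\<in>S. psd_on (pairs n) (residual n l T))"
proof -
  let ?P = "pairs n"
  have ln1: "ln (real n) \<ge> 1"
    using n exp_le by (subst ln_ge_iff) auto
  obtain j where j: "j > 0" "13 * ln (real n) \<le> 2 ^ j" "2 ^ j \<le> 2 * (13 * ln (real n))"
    using ln1 by (rule_tac power_of_two_between[of "13 * ln (real n)"]) auto
  define N :: nat where "N = 2 ^ j"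
  have N: "13 * ln (real n) \<le> N" "N \<le> 26 * ln (real n)" using j by (auto simp: N_def)
  have N1: "1 \<le> N" "even N" using j by (auto simp: N_def)
  have "52 * ln (real n) \<le> n"
  proof -
    have "ln (real n) = 2 * ln (sqrt n)" using n by (simp add: ln_sqrt)
    moreover have "ln (sqrt n) \<le> sqrt n" using n by (intro ln_bound) simp
    moreover have "104 \<le> sqrt n" using n by (intro real_le_rsqrt) simp
    then have "104 * sqrt n \<le> sqrt n * sqrt n" by (intro mult_right_mono) auto
    ultimately show ?thesis by simp
  qed
  then have N2: "2 * N \<le> n" using N by linarith
  define t where "t = 2 * (exp 1)\<^sup>2 * sqrt (n * N) * (8 * net_const\<^sup>2 * n)"
  have t0: "0 \<le> t" by (simp add: t_def)
  define S where "S = {T \<in> space (gauss_tensor n). trace_power n N T \<le> t ^ N}"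
  have symm: "(\<Sum>i<n. sym_kron T i p q) = (\<Sum>i<n. sym_kron T i q p)" for T p q
    by (simp add: sym_kron_def add.commute)
  have nn: "0 \<le> trace_power n N T" for T
    unfolding trace_power_def[OF N1(1) N2] unfolding N_def
    by (rule trace_power_nonneg[OF _ symm j(1)]) simp
  have S: "S \<in> sets (gauss_tensor n)" "measure (gauss_tensor n) S \<ge> 1 - 4 * real n ^ 3 * exp (- real N)"
    unfolding S_def using trace_power_tail[OF N1(1) N2 N1(2) t_def nn] by auto
  have "exp (- real N) \<le> 1 / real n ^ 13"
  proof -
    have "real n ^ 13 = exp (13 * ln (real n))"
      using n exp_of_nat_mult[of 13 "ln (real n)"] by simp
    also have "\<dots> \<le> exp N" using N by simp
    finally show ?thesis using n by (simp add: exp_minus field_simps)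
  qed
  then have "4 * real n ^ 3 * exp (- real N) \<le> 4 * real n ^ 3 * (1 / real n ^ 13)"
    by (intro mult_left_mono) auto
  also have "\<dots> = 4 / real n ^ 10" using n by (simp add: field_simps flip: power_add)
  finally have prob: "measure (gauss_tensor n) S \<ge> 1 - 4 / real n ^ 10" using S by linarith
  have tl: "t + n \<le> l\<^sup>2"
  proof -
    let ?y = "n * sqrt n * sqrt (ln (real n))"
    have "sqrt N \<le> sqrt (36 * ln (real n))" using N ln1 by (intro real_sqrt_le_mono) linarith
    also have "\<dots> = 6 * sqrt (ln (real n))" by (simp add: real_sqrt_mult)
    finally have "16 * (exp 1)\<^sup>2 * net_const\<^sup>2 * n * sqrt n * sqrt N
        \<le> 16 * (exp 1)\<^sup>2 * net_const\<^sup>2 * n * sqrt n * (6 * sqrt (ln (real n)))"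
      by (intro mult_left_mono) auto
    then have 1: "t \<le> 96 * (exp 1)\<^sup>2 * net_const\<^sup>2 * ?y"
      by (simp add: t_def real_sqrt_mult mult_ac)
    have "1 * 1 \<le> sqrt n * sqrt (ln (real n))"
      using n ln1 by (intro mult_mono) auto
    then have 2: "real n * 1 \<le> ?y" unfolding mult.assoc by (intro mult_left_mono) auto
    have lC: "bound_const\<^sup>2 = 96 * (exp 1)\<^sup>2 * net_const\<^sup>2 + 1" by (simp add: bound_const_def add_nonneg_nonneg)
    have p: "(real n powr (3/4))\<^sup>2 = n * sqrt n"
    proof -
      have "(real n powr (3/4))\<^sup>2 = real n powr (1 + 1/2)" by (simp add: power2_eq_square flip: powr_add)
      also have "\<dots> = n * sqrt n" unfolding powr_add using n by (simp add: powr_half_sqrt)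
      finally show ?thesis .
    qed
    have q: "(ln (real n) powr (1/4))\<^sup>2 = sqrt (ln (real n))"
      using ln1 by (simp add: power2_eq_square powr_half_sqrt flip: powr_add)
    have "l\<^sup>2 = (96 * (exp 1)\<^sup>2 * net_const\<^sup>2 + 1) * ?y"
      unfolding l_def power_mult_distrib lC p q by (simp add: mult_ac)
    with 1 2 show ?thesis by (simp add: distrib_right)
  qed
  have "psd_on ?P (residual n l T)" if "T \<in> S" for T
  proof (rule psd_residual[OF _ tl])
    fix u
    have tr: "(\<Sum>p\<in>?P. (matvec ?P (\<lambda>p q. \<Sum>i<n. sym_kron T i p q) ^^ 2 ^ j) (unitv p) p) \<le> t ^ 2 ^ j"
      using that unfolding S_def trace_power_def[OF N1(1) N2] unfolding N_def by blast
    show "(\<Sum>p\<in>?P. u p * matvec ?P (\<lambda>p q. \<Sum>i<n. sym_kron T i p q) u p) \<le> t * (L2_set u ?P)\<^sup>2"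
      by (rule quadratic_form_le[OF _ symm j(1) tr t0]) simp
  qed
  with S(1) prob show ?thesis by blast
qed

theorem mainTheorem2:
  "\<exists>C::real. C > 0 \<and> (\<exists>K::real. \<forall>n::nat. n \<ge> 2 \<longrightarrow>
     (\<exists>S \<in> sets (gauss_tensor n).
        measure (gauss_tensor n) S \<ge> 1 - K / real n ^ 10 \<and>
        (\<forall>T\<in>S.
           lambda_bounded n (cubic_poly n (\<lambda>i j k. T (i,j,k)))
              (C * real n powr (3/4) * ln (real n) powr (1/4))
         \<and> (\<forall>E. pseudo_expectation n 4 E \<longrightarrow>
              E (cubic_poly n (\<lambda>i j k. T (i,j,k)))
                \<le> C * real n powr (3/4) * ln (real n) powr (1/4)
                    * E (norm4_poly n) powr (3/4)))))"
proof (intro exI conjI allI impI)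
  have "0 < 96 * (exp 1)\<^sup>2 * net_const\<^sup>2 + (1 :: real)" by (intro add_nonneg_pos) auto
  then show C: "bound_const > 0" by (simp add: bound_const_def)
  fix n :: nat assume n: "n \<ge> 2"
  define l where "l = bound_const * real n powr (3/4) * ln (real n) powr (1/4)"
  have l: "l > 0" using C n by (simp add: l_def)
  \<comment> \<open>The 4 serves large n. The other summand makes the probability bound at most 0
    below the threshold, where the empty event is taken.\<close>
  let ?K = "4 + 10816 ^ 10 :: real"
  obtain S where S: "S \<in> sets (gauss_tensor n)" "measure (gauss_tensor n) S \<ge> 1 - ?K / real n ^ 10"
    "\<forall>T\<in>S. psd_on (pairs n) (residual n l T)"
  proof (cases "n \<ge> 10816")
    case True
    have "4 / real n ^ 10 \<le> ?K / real n ^ 10" by (intro divide_right_mono) auto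
    with gauss_tensor_event[OF True] that show ?thesis unfolding l_def by (meson diff_left_mono order_trans)
  next
    case False
    then have "real n ^ 10 \<le> 10816 ^ 10" by (intro power_mono) auto
    then have "real n ^ 10 \<le> ?K" by linarith
    then have "1 - ?K / real n ^ 10 \<le> 0" using n by (simp only: field_simps) simp
    then show ?thesis by (intro that[of "{}"]) auto
  qed
  have "lambda_bounded n (cubic_poly n (\<lambda>i j k. T (i, j, k))) l \<and>
      (\<forall>E. pseudo_expectation n 4 E \<longrightarrow>
        E (cubic_poly n (\<lambda>i j k. T (i, j, k))) \<le> l * E (norm4_poly n) powr (3/4))" if "T \<in> S" for T
  proof -
    have psd: "psd_on (pairs n) (residual n l T)" using S(3) that by blast
    show ?thesis
      using lambda_bounded_of_psd[OF psd l] pe_cubic_le[OF _ _ psd[unfolded residual_def[abs_def]]] l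
      by (auto intro: less_imp_le)
  qed
  with S(1,2) show "\<exists>S\<in>sets (gauss_tensor n). measure (gauss_tensor n) S \<ge> 1 - ?K / real n ^ 10 \<and>
        (\<forall>T\<in>S.
           lambda_bounded n (cubic_poly n (\<lambda>i j k. T (i,j,k)))
              (bound_const * real n powr (3/4) * ln (real n) powr (1/4))
         \<and> (\<forall>E. pseudo_expectation n 4 E \<longrightarrow>
              E (cubic_poly n (\<lambda>i j k. T (i,j,k)))
                \<le> bound_const * real n powr (3/4) * ln (real n) powr (1/4)
                    * E (norm4_poly n) powr (3/4)))"
    unfolding l_def by blast
qed

end
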